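(* Let $\Pi_f\subseteq Gr(k,n)$ be a positroid variety. Then $\Pi_f$ has a singular point if and only if $\Pi_f$ is singular at one of the $\binom{n}{k}$ torus-fixed points $\lambda\in\binom{[n]}{k}$ of $Gr(k,n)$; that is, the singular locus of $\Pi_f$ is nonempty if and only if it contains some $T$-fixed point $\lambda$. (Equivalently, $\Pi_f$ is smooth everywhere if and only if it is smooth at every $T$-fixed point $\lambda\in\Pi_f$.)
   Context: $Gr(k,n)$ is the Grassmannian of $k$-planes in $\mathbb{C}^n$, a point being the row span of a full-rank complex $k\times n$ matrix $M$ (considered modulo $GL(k)$ acting on the left). The torus $T$ of invertible diagonal $n\times n$ matrices acts by right multiplication. Its fixed points are the coordinate $k$-planes, indexed by $\lambda\in\binom{[n]}{k}$: $\lambda$ denotes the span of the coordinate vectors $e_i$, $i\in\lambda$. A bounded affine permutation (for $(k,n)$) is a bijection $f:\mathbb{Z}\to\mathbb{Z}$ with $f(i+n)=f(i)+n$, $i\le f(i)\le i+n$ for all $i$, and $\frac1n\sum_{i=1}^n (f(i)-i)=k$. Extending the columns of $M$ periodically modulo $n$, the positroid variety is $$\Pi_f=\{\text{row span}(M)\in Gr(k,n) : \operatorname{rank}(\text{columns } i,i+1,\dots,j \text{ of } M)\le (j-i+1)-\#\{a\ge i : f(a)\le j\}\ \text{ for all } i\le j\le i+n\}.$$ *)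

theory Defs
  imports
    "Jordan_Normal_Form.DL_Rank"
    Complex_Main
    "HOL-Library.Function_Algebras"
    "HOL-Library.Extended_Nat"
begin

section \<open>Grassmannian and positroid varieties\<close>

text \<open>Column and coordinate labels run over \<open>1, \<dots>, n\<close>, whereas the indices of
  matrices and vectors start at \<open>0\<close>: label \<open>i\<close> is index \<open>i - 1\<close>.\<close>

definition full_rank_mats :: "nat \<Rightarrow> nat \<Rightarrow> complex mat set" where
  "full_rank_mats k n = {M \<in> carrier_mat k n. vec_space.rank k M = k}"

definition Gr :: "nat \<Rightarrow> nat \<Rightarrow> complex vec set set" where
  "Gr k n = {vec_space.row_space n M | M. M \<in> full_rank_mats k n}"

definition bounded_affine_perm :: "nat \<Rightarrow> nat \<Rightarrow> (int \<Rightarrow> int) \<Rightarrow> bool" where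
  "bounded_affine_perm k n f \<longleftrightarrow>
     bij f \<and>
     (\<forall>i. f (i + int n) = f i + int n) \<and>
     (\<forall>i. i \<le> f i \<and> f i \<le> i + int n) \<and>
     1 / real n * (\<Sum>i = 1..int n. real_of_int (f i - i)) = real k"

definition periodic_col :: "complex mat \<Rightarrow> int \<Rightarrow> complex vec" where
  "periodic_col M i = col M (nat ((i - 1) mod int (dim_col M)))"

definition interval_rank :: "complex mat \<Rightarrow> int \<Rightarrow> int \<Rightarrow> nat" where
  "interval_rank M i j =
     vec_space.rank (dim_row M) (mat_of_cols (dim_row M) (map (periodic_col M) [i..j]))"

definition positroid_variety :: "nat \<Rightarrow> nat \<Rightarrow> (int \<Rightarrow> int) \<Rightarrow> complex vec set set" where
  "positroid_variety k n f =
     {vec_space.row_space n M | M. M \<in> full_rank_mats k n \<and>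
        (\<forall>i j. i \<le> j \<and> j \<le> i + int n \<longrightarrow>
           int (interval_rank M i j) \<le> (j - i + 1) - int (card {a. i \<le> a \<and> f a \<le> j}))}"

definition torus :: "nat \<Rightarrow> complex mat set" where
  "torus n = {D \<in> carrier_mat n n. diagonal_mat D \<and> invertible_mat D}"

definition torus_fixed_points :: "nat \<Rightarrow> nat \<Rightarrow> complex vec set set" where
  "torus_fixed_points k n =
     {W \<in> Gr k n. \<forall>M \<in> full_rank_mats k n. vec_space.row_space n M = W \<longrightarrow>
        (\<forall>D \<in> torus n. vec_space.row_space n (M * D) = W)}"

definition coord_plane :: "nat \<Rightarrow> nat set \<Rightarrow> complex vec set" where
  "coord_plane n L =
     LinearCombinations.module.span class_ring (module_vec TYPE(complex) n)
       ((\<lambda>i. unit_vec n (i - 1)) ` L)"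


section \<open>Dimension and tangent spaces in affine space\<close>

text \<open>Affine space with coordinates indexed by a finite set \<open>I\<close>: functions vanishing
  outside \<open>I\<close>.\<close>

definition affine_space :: "'i set \<Rightarrow> ('i \<Rightarrow> complex) set" where
  "affine_space I = {x. \<forall>i. i \<notin> I \<longrightarrow> x i = 0}"

text \<open>Since the ground field is infinite, polynomials in the coordinates are identified
  with the functions they define.\<close>

inductive_set poly_funs :: "'i set \<Rightarrow> (('i \<Rightarrow> complex) \<Rightarrow> complex) set"
  for I :: "'i set" where
  const: "(\<lambda>x. c) \<in> poly_funs I"
| coord: "i \<in> I \<Longrightarrow> (\<lambda>x. x i) \<in> poly_funs I"
| add: "g \<in> poly_funs I \<Longrightarrow> h \<in> poly_funs I \<Longrightarrow> (\<lambda>x. g x + h x) \<in> poly_funs I"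
| mult: "g \<in> poly_funs I \<Longrightarrow> h \<in> poly_funs I \<Longrightarrow> (\<lambda>x. g x * h x) \<in> poly_funs I"

definition zariski_closed :: "'i set \<Rightarrow> ('i \<Rightarrow> complex) set \<Rightarrow> bool" where
  "zariski_closed I Z \<longleftrightarrow>
     (\<exists>S \<subseteq> poly_funs I. Z = {x \<in> affine_space I. \<forall>g \<in> S. g x = 0})"

definition irreducible_closed :: "'i set \<Rightarrow> ('i \<Rightarrow> complex) set \<Rightarrow> bool" where
  "irreducible_closed I Z \<longleftrightarrow>
     zariski_closed I Z \<and> Z \<noteq> {} \<and>
     (\<forall>A B. zariski_closed I A \<and> zariski_closed I B \<and> Z = A \<union> B \<longrightarrow> Z = A \<or> Z = B)"

text \<open>Krull dimension of the local ring of the closed set \<open>X\<close> at \<open>p\<close>: prime ideals of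
  the local ring correspond to irreducible closed subsets of \<open>X\<close> through \<open>p\<close>.\<close>

definition local_dim :: "'i set \<Rightarrow> ('i \<Rightarrow> complex) set \<Rightarrow> ('i \<Rightarrow> complex) \<Rightarrow> enat" where
  "local_dim I X p =
     Sup {enat m | m. \<exists>Z :: nat \<Rightarrow> ('i \<Rightarrow> complex) set.
            (\<forall>r \<le> m. irreducible_closed I (Z r) \<and> p \<in> Z r \<and> Z r \<subseteq> X) \<and>
            (\<forall>r < m. Z r \<subset> Z (Suc r))}"

definition vanishing_ideal ::
    "'i set \<Rightarrow> ('i \<Rightarrow> complex) set \<Rightarrow> (('i \<Rightarrow> complex) \<Rightarrow> complex) set" where
  "vanishing_ideal I X = {g \<in> poly_funs I. \<forall>x \<in> X. g x = 0}"

text \<open>Zariski tangent space of the reduced variety \<open>X\<close> at \<open>p\<close>: the common kernel of the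
  differentials at \<open>p\<close> of all polynomials vanishing on \<open>X\<close>. The differential of \<open>g\<close> at \<open>p\<close>
  applied to \<open>v\<close> is the derivative of the one-variable polynomial \<open>g (p + t v)\<close> at \<open>t = 0\<close>.\<close>

definition zariski_tangent_space ::
    "'i set \<Rightarrow> ('i \<Rightarrow> complex) set \<Rightarrow> ('i \<Rightarrow> complex) \<Rightarrow> ('i \<Rightarrow> complex) set" where
  "zariski_tangent_space I X p =
     {v \<in> affine_space I. \<forall>g \<in> vanishing_ideal I X.
        ((\<lambda>t :: complex. g (\<lambda>i. p i + t * v i)) has_field_derivative 0) (at 0)}"

definition cscale :: "complex \<Rightarrow> ('i \<Rightarrow> complex) \<Rightarrow> ('i \<Rightarrow> complex)" where
  "cscale c v = (\<lambda>i. c * v i)"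

lemma vector_space_cscale: "vector_space cscale"
  by unfold_locales (auto simp: cscale_def fun_eq_iff algebra_simps)

definition affine_regular_at ::
    "'i set \<Rightarrow> ('i \<Rightarrow> complex) set \<Rightarrow> ('i \<Rightarrow> complex) \<Rightarrow> bool" where
  "affine_regular_at I X p \<longleftrightarrow>
     enat (vector_space.dim cscale (zariski_tangent_space I X p)) = local_dim I X p"


section \<open>Singular points of closed subvarieties of the Grassmannian\<close>

text \<open>The standard affine chart at \<open>L\<close>, a \<open>k\<close>-subset of \<open>{1..n}\<close>: a \<open>k\<close>-plane whose
  projection to the coordinates in \<open>L\<close> is bijective is the row span of a unique matrix that
  is the identity in the columns \<open>L\<close>. Its rows are labelled by the elements of \<open>L\<close> in
  increasing order, and the remaining entries \<open>a (i, j)\<close>, for \<open>i\<close> in \<open>L\<close> and \<open>j\<close> not in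
  \<open>L\<close>, are the affine coordinates.\<close>

definition chart_index :: "nat \<Rightarrow> nat set \<Rightarrow> (nat \<times> nat) set" where
  "chart_index n L = L \<times> ({1..n} - L)"

definition chart_mat :: "nat \<Rightarrow> nat set \<Rightarrow> (nat \<times> nat \<Rightarrow> complex) \<Rightarrow> complex mat" where
  "chart_mat n L a =
     mat (card L) n (\<lambda>(r, c).
       let i = sorted_list_of_set L ! r; j = Suc c
       in if j \<in> L then (if i = j then 1 else 0) else a (i, j))"

definition chart_plane :: "nat \<Rightarrow> nat set \<Rightarrow> (nat \<times> nat \<Rightarrow> complex) \<Rightarrow> complex vec set" where
  "chart_plane n L a = vec_space.row_space n (chart_mat n L a)"

definition chart_part ::
    "nat \<Rightarrow> nat set \<Rightarrow> complex vec set set \<Rightarrow> (nat \<times> nat \<Rightarrow> complex) set" where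
  "chart_part n L X = {a \<in> affine_space (chart_index n L). chart_plane n L a \<in> X}"

text \<open>The charts cover \<open>Gr k n\<close> and the transition maps are isomorphisms of varieties, so
  regularity at a point does not depend on the chart chosen around it.\<close>

definition singular_locus :: "nat \<Rightarrow> nat \<Rightarrow> complex vec set set \<Rightarrow> complex vec set set" where
  "singular_locus k n X =
     {chart_plane n L a | L a.
        L \<subseteq> {1..n} \<and> card L = k \<and> a \<in> chart_part n L X \<and>
        \<not> affine_regular_at (chart_index n L) (chart_part n L X) a}"

definition smooth_at :: "nat \<Rightarrow> nat \<Rightarrow> complex vec set set \<Rightarrow> complex vec set \<Rightarrow> bool" where
  "smooth_at k n X p \<longleftrightarrow> p \<in> X \<and> p \<notin> singular_locus k n X"

end

theory Submission
  imports Defs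
begin

text \<open>
  A singular point degenerates inside a single affine chart to a singular torus-fixed point;
  no transition between charts is ever made.

  Multiplying all affine coordinates of the chart at \<open>L\<close> by \<open>t\<close> multiplies the columns
  outside \<open>L\<close> of the representing matrix by \<open>t\<close>. This is the action of a one-parameter
  subgroup of the torus for \<open>t \<noteq> 0\<close>, and it contracts the whole chart to its origin, the
  coordinate plane of \<open>L\<close>, as \<open>t\<close> tends to \<open>0\<close>. The rank of a set of columns does
  not increase under this operation (not even for \<open>t = 0\<close>), so the part of a positroid variety
  in the chart is a cone (\<open>positroid_chart_part_scale\<close>).

  The heart of the proof is that a cone which is regular at its apex is a linear subspace, hence
  regular everywhere (\<open>cone_regular_if_regular_at_apex\<close>). A cone \<open>X\<close> lies in its tangent
  space \<open>T\<close> at the apex, because a polynomial that vanishes on a line through the apex has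
  derivative \<open>0\<close> along it. Regularity gives a chain of \<open>dim T + 1\<close> irreducible closed
  subsets of \<open>X\<close>. If \<open>X\<close> were smaller than \<open>T\<close>, then \<open>T\<close> itself would prolong this
  chain beyond the Krull dimension of \<open>T\<close>. So \<open>X = T\<close>. Consequently a singular point
  anywhere in the chart forces the origin of the chart to be singular.

  The bound on the Krull dimension (\<open>irreducible_chain_length_le\<close>) comes from counting
  monomials. A chain \<open>Z 0 \<subset> \<dots> \<subset> Z m\<close> of irreducible sets in a \<open>d\<close>-dimensional space
  yields polynomials \<open>g r\<close> that vanish on \<open>Z r\<close> but not on \<open>Z (Suc r)\<close>. Their products with
  exponents at most \<open>N\<close> are \<open>(N + 1) ^ m\<close> linearly independent functions, and they all lie
  in a space of polynomials in \<open>d\<close> variables whose dimension grows at most like \<open>N ^ d\<close>. Letting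
  \<open>N\<close> grow gives \<open>m \<le> d\<close>.
\<close>

interpretation cfun: vector_space "cscale :: complex \<Rightarrow> ('i \<Rightarrow> complex) \<Rightarrow> 'i \<Rightarrow> complex"
  by (rule vector_space_cscale)

lemma sum_fun_apply: "(\<Sum>a\<in>A. f a) x = (\<Sum>a\<in>A. f a x)" for f :: "'b \<Rightarrow> 'a \<Rightarrow> complex"
  by (induction A rule: infinite_finite_induct) auto

section \<open>Polynomial functions\<close>

lemma poly_funs_sum: "(\<And>a. a \<in> A \<Longrightarrow> h a \<in> poly_funs I) \<Longrightarrow> (\<lambda>x. \<Sum>a\<in>A. h a x) \<in> poly_funs I"
  by (induction A rule: infinite_finite_induct) (auto intro: poly_funs.intros)

lemma poly_funs_power: "g \<in> poly_funs I \<Longrightarrow> (\<lambda>x. g x ^ e) \<in> poly_funs I"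
  by (induction e) (auto intro: poly_funs.intros)

text \<open>Restriction to a line turns questions about polynomial functions on affine space into
  questions about the finitely many roots of a polynomial in one variable.\<close>

lemma poly_funs_line:
  assumes "g \<in> poly_funs I"
  shows "\<exists>p. \<forall>t. g (\<lambda>i. x i + t * v i) = poly p t"
  using assms
proof induction
  case (const c)
  show ?case by (rule exI[of _ "[:c:]"]) simp
next
  case (coord i)
  show ?case by (rule exI[of _ "[:x i, v i:]"]) simp
next
  case (add g h)
  then obtain p q where "\<forall>t. g (\<lambda>i. x i + t * v i) = poly p t"
    "\<forall>t. h (\<lambda>i. x i + t * v i) = poly q t" by blast
  then show ?case by (intro exI[of _ "p + q"]) simp
next
  case (mult g h)
  then obtain p q where "\<forall>t. g (\<lambda>i. x i + t * v i) = poly p t"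
    "\<forall>t. h (\<lambda>i. x i + t * v i) = poly q t" by blast
  then show ?case by (intro exI[of _ "p * q"]) simp
qed

text \<open>The linearity of the differential in the direction is what makes the Zariski tangent
  space a linear subspace.\<close>

lemma poly_funs_differential:
  assumes "g \<in> poly_funs I"
  shows "\<exists>l. (\<forall>v w. l (v + w) = l v + l w) \<and> (\<forall>c v. l (cscale c v) = c * l v) \<and>
             (\<forall>v. ((\<lambda>t::complex. g (\<lambda>i. p i + t * v i)) has_field_derivative l v) (at 0))"
  using assms
proof induction
  case (const c)
  show ?case by (rule exI[of _ "\<lambda>v. 0"]) simp
next
  case (coord i)
  show ?case by (rule exI[of _ "\<lambda>v. v i"]) (auto simp: cscale_def intro!: derivative_eq_intros)
next
  case (add g h)
  then obtain l l' where *: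
    "\<forall>v w. l (v + w) = l v + l w" "\<forall>c v. l (cscale c v) = c * l v"
    "\<forall>v. ((\<lambda>t::complex. g (\<lambda>i. p i + t * v i)) has_field_derivative l v) (at 0)"
    "\<forall>v w. l' (v + w) = l' v + l' w" "\<forall>c v. l' (cscale c v) = c * l' v"
    "\<forall>v. ((\<lambda>t::complex. h (\<lambda>i. p i + t * v i)) has_field_derivative l' v) (at 0)" by blast
  have "((\<lambda>t::complex. g (\<lambda>i. p i + t * v i) + h (\<lambda>i. p i + t * v i))
          has_field_derivative l v + l' v) (at 0)" for v
    using DERIV_add[OF *(3)[rule_format, of v] *(6)[rule_format, of v]] .
  with * show ?case
    by (intro exI[of _ "\<lambda>v. l v + l' v"]) (simp only: *, simp add: algebra_simps)
next
  case (mult g h)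
  then obtain l l' where *:
    "\<forall>v w. l (v + w) = l v + l w" "\<forall>c v. l (cscale c v) = c * l v"
    "\<forall>v. ((\<lambda>t::complex. g (\<lambda>i. p i + t * v i)) has_field_derivative l v) (at 0)"
    "\<forall>v w. l' (v + w) = l' v + l' w" "\<forall>c v. l' (cscale c v) = c * l' v"
    "\<forall>v. ((\<lambda>t::complex. h (\<lambda>i. p i + t * v i)) has_field_derivative l' v) (at 0)" by blast
  have "((\<lambda>t::complex. g (\<lambda>i. p i + t * v i) * h (\<lambda>i. p i + t * v i))
          has_field_derivative l v * h p + l' v * g p) (at 0)" for v
    using DERIV_mult[OF *(3)[rule_format, of v] *(6)[rule_format, of v]] by simp
  with * show ?case
    by (intro exI[of _ "\<lambda>v. l v * h p + l' v * g p"]) (simp only: *, simp add: algebra_simps)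
qed

text \<open>The vanishing ideal of an irreducible set is prime: the zero loci of the two factors
  would otherwise decompose it.\<close>

lemma irreducible_closed_mult_zero:
  assumes Z: "irreducible_closed I Z" and g: "g \<in> poly_funs I" and h: "h \<in> poly_funs I"
    and gh: "\<forall>x\<in>Z. g x * h x = 0"
  shows "(\<forall>x\<in>Z. g x = 0) \<or> (\<forall>x\<in>Z. h x = 0)"
proof -
  obtain S where S: "S \<subseteq> poly_funs I" "Z = {x \<in> affine_space I. \<forall>g \<in> S. g x = 0}"
    using Z unfolding irreducible_closed_def zariski_closed_def by (elim conjE exE)
  have *: "zariski_closed I {x\<in>Z. g x = 0}" if "g \<in> poly_funs I" for g
    unfolding zariski_closed_def using S that by (intro exI[of _ "insert g S"]) auto
  have "Z = {x\<in>Z. g x = 0} \<union> {x\<in>Z. h x = 0}" using gh by auto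
  then have "Z = {x\<in>Z. g x = 0} \<or> Z = {x\<in>Z. h x = 0}"
    using Z *[OF g] *[OF h] unfolding irreducible_closed_def by blast
  then show ?thesis by blast
qed

lemma psubset_separating_poly:
  assumes "zariski_closed I Y" "zariski_closed I Z" "Y \<subset> Z"
  shows "\<exists>g\<in>poly_funs I. (\<forall>x\<in>Y. g x = 0) \<and> (\<exists>x\<in>Z. g x \<noteq> 0)"
  using assms unfolding zariski_closed_def by blast

section \<open>Krull dimension of an affine space\<close>

text \<open>The exponent of the variable with index \<open>r\<close> is the list entry followed by exactly
  \<open>r\<close> further entries, so that prepending an entry introduces the variable of next higher
  index and leaves the existing ones alone.\<close>

definition exponents :: "nat \<Rightarrow> nat \<Rightarrow> nat list set" where
  "exponents m N = {as. set as \<subseteq> {..N} \<and> length as = m}"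

lemma finite_exponents: "finite (exponents m N)"
  unfolding exponents_def by (simp add: finite_lists_length_eq)

lemma card_exponents: "card (exponents m N) = Suc N ^ m"
  unfolding exponents_def by (simp add: card_lists_length_eq)

lemma exponents_0: "exponents 0 N = {[]}"
  by (auto simp: exponents_def)

lemma sum_exponents_Suc:
  "(\<Sum>as\<in>exponents (Suc m) N. F as) = (\<Sum>j\<le>N. \<Sum>as\<in>exponents m N. F (j # as))"
proof -
  have "exponents (Suc m) N = (\<lambda>(j, as). j # as) ` ({..N} \<times> exponents m N)"
    by (auto simp: exponents_def length_Suc_conv image_iff)
  moreover have "inj_on (\<lambda>(j, as). j # as) ({..N} \<times> exponents m N)"
    by (auto simp: inj_on_def)
  ultimately have "(\<Sum>as\<in>exponents (Suc m) N. F as) =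
      (\<Sum>(j, as)\<in>{..N} \<times> exponents m N. F (j # as))"
    by (simp add: sum.reindex split_def)
  then show ?thesis by (simp add: sum.cartesian_product)
qed

fun power_product :: "(nat \<Rightarrow> 'a \<Rightarrow> complex) \<Rightarrow> nat list \<Rightarrow> 'a \<Rightarrow> complex" where
  "power_product g [] x = 1"
| "power_product g (a # as) x = g (length as) x ^ a * power_product g as x"

lemma power_product_poly:
  "(\<And>r. r < length as \<Longrightarrow> g r \<in> poly_funs I) \<Longrightarrow> power_product g as \<in> poly_funs I"
proof (induction as)
  case Nil
  have "power_product g [] = (\<lambda>x. 1)" by (simp add: fun_eq_iff)
  then show ?case by (simp add: poly_funs.const)
next
  case (Cons a as)
  have "power_product g (a # as) = (\<lambda>x. g (length as) x ^ a * power_product g as x)"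
    by (simp add: fun_eq_iff)
  with Cons show ?case by (auto intro!: poly_funs.mult poly_funs_power)
qed

text \<open>The induction runs along the chain. In a vanishing combination the lowest power of the
  last polynomial can be cancelled on \<open>Z (Suc m)\<close>, since the latter is irreducible. Restricted to
  \<open>Z m\<close>, where the last polynomial vanishes, only the lowest coefficient survives; it is a
  combination of the previous products and is covered by the induction hypothesis.\<close>

lemma power_products_independent_on_chain:
  assumes "\<And>r. r \<le> m \<Longrightarrow> irreducible_closed I (Z r)"
    and "\<And>r. r < m \<Longrightarrow> Z r \<subset> Z (Suc r)"
    and "\<And>r. r < m \<Longrightarrow> g r \<in> poly_funs I"
    and "\<And>r x. r < m \<Longrightarrow> x \<in> Z r \<Longrightarrow> g r x = 0"
    and "\<And>r. r < m \<Longrightarrow> \<exists>x\<in>Z (Suc r). g r x \<noteq> 0"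
    and "\<And>x. x \<in> Z m \<Longrightarrow> (\<Sum>as\<in>exponents m N. c as * power_product g as x) = 0"
  shows "\<forall>as\<in>exponents m N. c as = 0"
  using assms
proof (induction m arbitrary: c)
  case 0
  from "0.prems"(1) have "Z 0 \<noteq> {}" by (auto simp: irreducible_closed_def)
  then show ?case using "0.prems"(6) by (auto simp: exponents_0)
next
  case (Suc m)
  define H where "H j x = (\<Sum>as\<in>exponents m N. c (j # as) * power_product g as x)" for j x
  define nz where "nz j \<longleftrightarrow> j \<le> N \<and> (\<exists>as\<in>exponents m N. c (j # as) \<noteq> 0)" for j
  have gm: "g m \<in> poly_funs I" using Suc.prems(3) by simp
  have H_poly: "H j \<in> poly_funs I" for j
    unfolding H_def [abs_def] using Suc.prems(3)
    by (auto intro!: poly_funs_sum poly_funs.mult poly_funs.const power_product_poly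
        simp: exponents_def)
  have tot: "(\<Sum>j\<le>N. g m x ^ j * H j x) = 0" if "x \<in> Z (Suc m)" for x
  proof -
    have "(\<Sum>as\<in>exponents (Suc m) N. c as * power_product g as x) = (\<Sum>j\<le>N. g m x ^ j * H j x)"
      unfolding sum_exponents_Suc H_def sum_distrib_left
      by (intro sum.cong refl) (auto simp: exponents_def algebra_simps)
    with Suc.prems(6)[OF that] show ?thesis by simp
  qed
  have no: "\<not> nz j" for j
  proof
    assume "nz j"
    define j0 where "j0 = (LEAST j. nz j)"
    have j0: "nz j0" unfolding j0_def using \<open>nz j\<close> by (rule LeastI)
    have below: "\<not> nz i" if "i < j0" for i using that not_less_Least unfolding j0_def by blast
    have j0N: "j0 \<le> N" using j0 by (simp add: nz_def)
    have Hz: "H i x = 0" if "i < j0" for i x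
      using below[OF that] that j0N unfolding nz_def H_def by (auto intro!: sum.neutral)
    \<comment> \<open>the combination divided by the power \<open>j0\<close> of the last polynomial\<close>
    define Q where "Q x = (\<Sum>i\<in>{j0..N}. g m x ^ (i - j0) * H i x)" for x
    have Q_poly: "Q \<in> poly_funs I"
      unfolding Q_def [abs_def] by (intro poly_funs_sum poly_funs.mult poly_funs_power gm H_poly)
    have split: "(\<Sum>i\<le>N. g m x ^ i * H i x) = g m x ^ j0 * Q x" for x
    proof -
      have "(\<Sum>i\<le>N. g m x ^ i * H i x) = (\<Sum>i\<in>{j0..N}. g m x ^ i * H i x)"
        by (rule sum.mono_neutral_right) (auto simp: Hz)
      also have "\<dots> = g m x ^ j0 * Q x"
        unfolding Q_def sum_distrib_left
        by (intro sum.cong refl) (simp add: mult.assoc[symmetric] power_add[symmetric])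
      finally show ?thesis .
    qed
    have "\<forall>x\<in>Z (Suc m). g m x ^ j0 * Q x = 0" using tot split by metis
    then have "(\<forall>x\<in>Z (Suc m). g m x ^ j0 = 0) \<or> (\<forall>x\<in>Z (Suc m). Q x = 0)"
      by (intro irreducible_closed_mult_zero[OF Suc.prems(1)] poly_funs_power gm Q_poly) simp_all
    then have Q0: "\<forall>x\<in>Z (Suc m). Q x = 0" using Suc.prems(5)[of m] by auto
    have "H j0 x = 0" if x: "x \<in> Z m" for x
    proof -
      have "g m x = 0" using Suc.prems(4) x by simp
      have "Q x = (\<Sum>i\<in>{j0..N}. if i = j0 then H i x else 0)"
        unfolding Q_def by (rule sum.cong) (auto simp: \<open>g m x = 0\<close>)
      then have "Q x = H j0 x" using j0N by simp
      moreover have "x \<in> Z (Suc m)" using Suc.prems(2)[of m] x by auto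
      ultimately show ?thesis using Q0 by simp
    qed
    then have "\<forall>as\<in>exponents m N. c (j0 # as) = 0"
      by (intro Suc.IH) (use Suc.prems in \<open>auto simp: H_def\<close>)
    with j0 show False by (auto simp: nz_def)
  qed
  then show ?case by (auto simp: exponents_def length_Suc_conv nz_def)
qed

text \<open>The family is indexed rather than a set, so that a repeated vector counts as a relation.\<close>

lemma nontrivial_relation:
  fixes v :: "'e \<Rightarrow> 'i \<Rightarrow> complex"
  assumes "finite E" "finite B" "card B < card E" "\<And>e. e \<in> E \<Longrightarrow> v e \<in> cfun.span B"
  shows "\<exists>c. (\<exists>e\<in>E. c e \<noteq> 0) \<and> (\<forall>x. (\<Sum>e\<in>E. c e * v e x) = 0)"
proof (cases "inj_on v E")
  case True
  have "cfun.dependent (v ` E)"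
  proof (rule ccontr)
    assume "\<not> ?thesis"
    then have "card (v ` E) \<le> card B"
      using cfun.independent_span_bound[OF \<open>finite B\<close>, of "v ` E"] assms(4) by auto
    then show False using assms(3) card_image[OF True] by simp
  qed
  then obtain u where u: "\<exists>w\<in>v ` E. u w \<noteq> 0" "(\<Sum>w\<in>v ` E. cscale (u w) w) = 0"
    using cfun.dependent_finite[of "v ` E"] assms(1) by auto
  have "(\<Sum>e\<in>E. u (v e) * v e x) = 0" for x
  proof -
    have "(\<Sum>w\<in>v ` E. cscale (u w) w) x = 0" using u(2) by simp
    then show ?thesis by (simp add: sum_fun_apply sum.reindex[OF True] cscale_def)
  qed
  then show ?thesis using u(1) by (intro exI[of _ "\<lambda>e. u (v e)"]) auto
next
  case False
  then obtain e e' where e: "e \<in> E" "e' \<in> E" "e \<noteq> e'" "v e = v e'" by (auto simp: inj_on_def)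
  define c where "c = (\<lambda>a. if a = e then 1 else if a = e' then -1 else (0::complex))"
  have "(\<Sum>a\<in>E. c a * v a x) = 0" for x
  proof -
    have "(\<Sum>a\<in>E. c a * v a x) = (\<Sum>a\<in>{e, e'}. c a * v a x)"
      by (rule sum.mono_neutral_right) (use assms(1) e in \<open>auto simp: c_def\<close>)
    then show ?thesis using e by (simp add: c_def)
  qed
  then show ?thesis using e by (intro exI[of _ c]) (auto simp: c_def)
qed

definition monomials :: "nat \<Rightarrow> nat \<Rightarrow> ((nat \<Rightarrow> complex) \<Rightarrow> complex) set" where
  "monomials d D = power_product (\<lambda>l s. s l) ` exponents d D"

lemma finite_monomials: "finite (monomials d D)"
  by (simp add: monomials_def finite_exponents)

lemma card_monomials_le: "card (monomials d D) \<le> Suc D ^ d"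
  unfolding monomials_def using card_image_le[OF finite_exponents] by (metis card_exponents)

lemma span_monomials_mono: "D \<le> D' \<Longrightarrow> cfun.span (monomials d D) \<subseteq> cfun.span (monomials d D')"
  by (rule cfun.span_mono) (fastforce simp: monomials_def exponents_def)

lemma power_product_map2:
  "length as = length bs \<Longrightarrow>
   power_product g (map2 (+) as bs) x = power_product g as x * power_product g bs x"
  by (induction as bs rule: list_induct2) (auto simp: power_add)

lemma power_product_replicate_0: "power_product g (replicate d 0) x = 1"
  by (induction d) auto

lemma map2_exponents:
  "as \<in> exponents d D \<Longrightarrow> bs \<in> exponents d D' \<Longrightarrow> map2 (+) as bs \<in> exponents d (D + D')"
  unfolding exponents_def
  by (auto intro!: add_mono dest: set_zip_leftD set_zip_rightD)

lemma const_monomial: "(\<lambda>s. 1) \<in> monomials d D"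
  unfolding monomials_def
  by (rule image_eqI[of _ _ "replicate d 0"])
    (auto simp: fun_eq_iff power_product_replicate_0 exponents_def)

lemma coord_monomial: "l < d \<Longrightarrow> (\<lambda>s. s l) \<in> monomials d 1"
proof (induction d)
  case (Suc d)
  show ?case
  proof (cases "l = d")
    case True
    show ?thesis unfolding monomials_def
      by (rule image_eqI[of _ _ "1 # replicate d 0"])
        (auto simp: True fun_eq_iff power_product_replicate_0 exponents_def)
  next
    case False
    with Suc obtain as where "as \<in> exponents d 1" "(\<lambda>s. s l) = power_product (\<lambda>l s. s l) as"
      unfolding monomials_def by auto
    then show ?thesis unfolding monomials_def
      by (intro image_eqI[of _ _ "0 # as"]) (auto simp: exponents_def fun_eq_iff)
  qed
qed simp

text \<open>The bound on the exponents behaves like a degree: it adds up under multiplication. It is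
  imposed on each variable separately because the monomials are then counted by a plain
  power.\<close>

lemma span_monomials_mult:
  assumes f: "f \<in> cfun.span (monomials d D)" and h: "h \<in> cfun.span (monomials d D')"
  shows "(\<lambda>s. f s * h s) \<in> cfun.span (monomials d (D + D'))"
  using f
proof (induction rule: cfun.span_induct_alt)
  case base
  have "(\<lambda>s. (0::(nat \<Rightarrow> complex) \<Rightarrow> complex) s * h s) = 0" by (simp add: fun_eq_iff)
  then show ?case by (simp only: cfun.span_zero)
next
  case (step c u w)
  then obtain as where as: "as \<in> exponents d D" "u = power_product (\<lambda>l s. s l) as"
    by (auto simp: monomials_def)
  have "(\<lambda>s. u s * h s) \<in> cfun.span (monomials d (D + D'))"
    using h
  proof (induction rule: cfun.span_induct_alt)
    case base
    have "(\<lambda>s. u s * (0::(nat \<Rightarrow> complex) \<Rightarrow> complex) s) = 0" by (simp add: fun_eq_iff)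
    then show ?case by (simp only: cfun.span_zero)
  next
    case (step c' u' w')
    then obtain bs where bs: "bs \<in> exponents d D'" "u' = power_product (\<lambda>l s. s l) bs"
      by (auto simp: monomials_def)
    have "(\<lambda>s. u s * u' s) = power_product (\<lambda>l s. s l) (map2 (+) as bs)"
      using as bs by (simp add: fun_eq_iff power_product_map2 exponents_def)
    then have "(\<lambda>s. u s * u' s) \<in> monomials d (D + D')"
      using map2_exponents[OF as(1) bs(1)] by (simp add: monomials_def)
    then have "cscale c' (\<lambda>s. u s * u' s) + (\<lambda>s. u s * w' s) \<in> cfun.span (monomials d (D + D'))"
      by (rule cfun.span_add[OF cfun.span_scale[OF cfun.span_base] step.IH])
    moreover have "cscale c' (\<lambda>s. u s * u' s) + (\<lambda>s. u s * w' s) = (\<lambda>s. u s * (cscale c' u' + w') s)"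
      by (simp add: fun_eq_iff cscale_def algebra_simps)
    ultimately show ?case by simp
  qed
  then have "cscale c (\<lambda>s. u s * h s) + (\<lambda>s. w s * h s) \<in> cfun.span (monomials d (D + D'))"
    using step.IH by (intro cfun.span_add cfun.span_scale)
  moreover have "cscale c (\<lambda>s. u s * h s) + (\<lambda>s. w s * h s) = (\<lambda>s. (cscale c u + w) s * h s)"
    by (simp add: fun_eq_iff cscale_def algebra_simps)
  ultimately show ?case by simp
qed

definition lin_param :: "nat \<Rightarrow> (nat \<Rightarrow> 'i \<Rightarrow> complex) \<Rightarrow> (nat \<Rightarrow> complex) \<Rightarrow> 'i \<Rightarrow> complex" where
  "lin_param d b s = (\<lambda>i. \<Sum>l<d. s l * b l i)"

text \<open>On a space parametrized linearly by \<open>d\<close> coordinates every polynomial function becomes a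
  polynomial in these \<open>d\<close> coordinates.\<close>

lemma poly_fun_pullback:
  assumes "g \<in> poly_funs I"
  shows "\<exists>D. (\<lambda>s. g (lin_param d b s)) \<in> cfun.span (monomials d D)"
  using assms
proof induction
  case (const c)
  have "cscale c (\<lambda>s :: nat \<Rightarrow> complex. 1) \<in> cfun.span (monomials d 0)"
    by (intro cfun.span_scale cfun.span_base const_monomial)
  moreover have "cscale c (\<lambda>s :: nat \<Rightarrow> complex. 1) = (\<lambda>s. c)" by (simp add: cscale_def)
  ultimately have "(\<lambda>s. c) \<in> cfun.span (monomials d 0)" by simp
  then show ?case by (rule exI)
next
  case (coord i)
  have "(\<Sum>l<d. cscale (b l i) (\<lambda>s. s l)) \<in> cfun.span (monomials d 1)"
    by (intro cfun.span_sum cfun.span_scale cfun.span_base coord_monomial) simp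
  moreover have "(\<Sum>l<d. cscale (b l i) (\<lambda>s. s l)) = (\<lambda>s. lin_param d b s i)"
    by (simp add: fun_eq_iff sum_fun_apply cscale_def lin_param_def mult.commute)
  ultimately have "(\<lambda>s. lin_param d b s i) \<in> cfun.span (monomials d 1)" by simp
  then show ?case by (rule exI)
next
  case (add g h)
  then obtain D D' where D: "(\<lambda>s. g (lin_param d b s)) \<in> cfun.span (monomials d D)"
    "(\<lambda>s. h (lin_param d b s)) \<in> cfun.span (monomials d D')" by blast
  have "(\<lambda>s. g (lin_param d b s)) + (\<lambda>s. h (lin_param d b s)) \<in> cfun.span (monomials d (max D D'))"
    using D span_monomials_mono[of D "max D D'" d] span_monomials_mono[of D' "max D D'" d]
    by (intro cfun.span_add) auto
  then show ?case unfolding plus_fun_def by (rule exI)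
next
  case (mult g h)
  then show ?case using span_monomials_mult by blast
qed

lemma span_monomials_power:
  "f \<in> cfun.span (monomials d D) \<Longrightarrow> (\<lambda>s. f s ^ e) \<in> cfun.span (monomials d (D * e))"
proof (induction e)
  case 0
  then show ?case using cfun.span_base[OF const_monomial] by simp
next
  case (Suc e)
  then show ?case using span_monomials_mult[of f d D "\<lambda>s. f s ^ e" "D * e"] by simp
qed

lemma power_product_pullback:
  assumes "\<And>r. r < length as \<Longrightarrow> (\<lambda>s. g r (\<phi> s)) \<in> cfun.span (monomials d D)"
    and "set as \<subseteq> {..N}"
  shows "(\<lambda>s. power_product g as (\<phi> s)) \<in> cfun.span (monomials d (D * N * length as))"
  using assms
proof (induction as)
  case Nil
  then show ?case using cfun.span_base[OF const_monomial] by simp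
next
  case (Cons a as)
  have "(\<lambda>s. g (length as) (\<phi> s) ^ a) \<in> cfun.span (monomials d (D * a))"
    using Cons.prems by (intro span_monomials_power) auto
  moreover have "D * a \<le> D * N" using Cons.prems by auto
  ultimately have "(\<lambda>s. g (length as) (\<phi> s) ^ a) \<in> cfun.span (monomials d (D * N))"
    using span_monomials_mono by blast
  moreover have "(\<lambda>s. power_product g as (\<phi> s)) \<in> cfun.span (monomials d (D * N * length as))"
    using Cons by auto
  ultimately show ?case using span_monomials_mult by fastforce
qed

text \<open>If \<open>D\<close> bounds the exponents in the polynomials separating consecutive members of the
  chain, the \<open>(N + 1) ^ m\<close> independent products lie in the span of at most
  \<open>(D * N * m + 1) ^ d\<close> monomials. For large \<open>N\<close> this forces \<open>m \<le> d\<close>.\<close>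

lemma irreducible_chain_length_le:
  assumes irr: "\<And>r. r \<le> m \<Longrightarrow> irreducible_closed I (Z r)"
    and strict: "\<And>r. r < m \<Longrightarrow> Z r \<subset> Z (Suc r)"
    and param: "Z m \<subseteq> range (lin_param d b)"
  shows "m \<le> d"
proof (rule ccontr)
  assume "\<not> m \<le> d"
  have "\<exists>g\<in>poly_funs I. (\<forall>x\<in>Z r. g x = 0) \<and> (\<exists>x\<in>Z (Suc r). g x \<noteq> 0)" if "r < m" for r
    using that irr[of r] irr[of "Suc r"] strict[of r]
    by (intro psubset_separating_poly) (auto simp: irreducible_closed_def)
  then obtain g where g: "\<And>r. r < m \<Longrightarrow> g r \<in> poly_funs I"
    "\<And>r x. r < m \<Longrightarrow> x \<in> Z r \<Longrightarrow> g r x = 0" "\<And>r. r < m \<Longrightarrow> \<exists>x\<in>Z (Suc r). g r x \<noteq> 0"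
    by metis
  have "\<exists>D. (\<lambda>s. g r (lin_param d b s)) \<in> cfun.span (monomials d D)" if "r < m" for r
    using poly_fun_pullback[OF g(1)[OF that]] .
  then obtain Df where Df: "\<And>r. r < m \<Longrightarrow> (\<lambda>s. g r (lin_param d b s)) \<in> cfun.span (monomials d (Df r))"
    by metis
  define D where "D = (\<Sum>r<m. Df r)"
  have D: "(\<lambda>s. g r (lin_param d b s)) \<in> cfun.span (monomials d D)" if "r < m" for r
  proof -
    have "Df r \<le> D" unfolding D_def using that by (intro member_le_sum) auto
    then show ?thesis using Df[OF that] span_monomials_mono by blast
  qed
  have bound: "Suc N ^ m \<le> Suc (D * N * m) ^ d" for N
  proof (rule ccontr)
    assume "\<not> ?thesis"
    then have lt: "card (monomials d (D * N * m)) < card (exponents m N)"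
      using card_monomials_le[of d "D * N * m"] by (simp add: card_exponents)
    have "\<exists>c. (\<exists>as\<in>exponents m N. c as \<noteq> 0) \<and>
        (\<forall>s. (\<Sum>as\<in>exponents m N. c as * power_product g as (lin_param d b s)) = 0)"
    proof (rule nontrivial_relation[OF finite_exponents finite_monomials lt])
      fix as assume "as \<in> exponents m N"
      then show "(\<lambda>s. power_product g as (lin_param d b s)) \<in> cfun.span (monomials d (D * N * m))"
        using power_product_pullback[of as g "lin_param d b" d D N] D by (auto simp: exponents_def)
    qed
    then obtain c where c: "\<exists>as\<in>exponents m N. c as \<noteq> 0"
      "\<And>s. (\<Sum>as\<in>exponents m N. c as * power_product g as (lin_param d b s)) = 0" by blast
    have "\<forall>as\<in>exponents m N. c as = 0"
    proof (rule power_products_independent_on_chain[where Z = Z and g = g])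
      fix x assume "x \<in> Z m"
      then obtain s where "x = lin_param d b s" using param by auto
      then show "(\<Sum>as\<in>exponents m N. c as * power_product g as x) = 0" using c(2) by simp
    qed (use irr strict g in auto)
    with c(1) show False by blast
  qed
  \<comment> \<open>if \<open>d < m\<close>, the bound yields \<open>N + 1 \<le> (D * m + 1) ^ d\<close>, which fails for this \<open>N\<close>\<close>
  define N where "N = Suc (D * m) ^ d"
  have "Suc N * Suc N ^ d = Suc N ^ Suc d" by simp
  also have "\<dots> \<le> Suc N ^ m" using \<open>\<not> m \<le> d\<close> by (intro power_increasing) auto
  also have "\<dots> \<le> Suc (D * N * m) ^ d" by (rule bound)
  also have "\<dots> \<le> (Suc (D * m) * Suc N) ^ d" by (intro power_mono) (auto simp: algebra_simps)
  also have "\<dots> = Suc (D * m) ^ d * Suc N ^ d" by (rule power_mult_distrib)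
  also have "\<dots> = N * Suc N ^ d" by (simp only: N_def [symmetric])
  finally show False by simp
qed

section \<open>Linear subspaces\<close>

lemma subspace_affine_space: "cfun.subspace (affine_space I)"
  by (auto simp: cfun.subspace_def affine_space_def cscale_def)

definition coord_vec :: "'i \<Rightarrow> 'i \<Rightarrow> complex" where
  "coord_vec i = (\<lambda>j. if j = i then 1 else 0)"

lemma affine_space_expand:
  assumes "finite I" "v \<in> affine_space I"
  shows "v = (\<Sum>i\<in>I. cscale (v i) (coord_vec i))"
proof
  fix j
  have "(\<Sum>i\<in>I. cscale (v i) (coord_vec i)) j = (\<Sum>i\<in>I. if i = j then v i else 0)"
    unfolding sum_fun_apply by (rule sum.cong) (auto simp: cscale_def coord_vec_def)
  also have "\<dots> = v j" using assms by (simp add: affine_space_def)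
  finally show "v j = (\<Sum>i\<in>I. cscale (v i) (coord_vec i)) j" by simp
qed

text \<open>A basis in a fixed order; the spans of its initial segments form a complete flag, the
  source of maximal chains of irreducible subsets.\<close>

lemma subspace_flag:
  assumes I: "finite I" and T: "cfun.subspace T" "T \<subseteq> affine_space I"
  obtains b :: "nat \<Rightarrow> 'i \<Rightarrow> complex" where
    "T = cfun.span (b ` {..<cfun.dim T})"
    "\<And>r. r < cfun.dim T \<Longrightarrow> b r \<notin> cfun.span (b ` {..<r})"
proof -
  obtain B where B: "B \<subseteq> T" "cfun.independent B" "T \<subseteq> cfun.span B" "card B = cfun.dim T"
    by (rule cfun.basis_exists)
  have "affine_space I \<subseteq> cfun.span (coord_vec ` I)"
  proof
    fix v assume "v \<in> affine_space I"
    then have "v = (\<Sum>i\<in>I. cscale (v i) (coord_vec i))" using I by (rule affine_space_expand[rotated])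
    also have "\<dots> \<in> cfun.span (coord_vec ` I)"
      by (intro cfun.span_sum cfun.span_scale cfun.span_base) auto
    finally show "v \<in> cfun.span (coord_vec ` I)" .
  qed
  then have "finite B"
    using cfun.independent_span_bound[of "coord_vec ` I" B] I B T by auto
  then obtain b where b: "bij_betw b {..<cfun.dim T} B"
    using ex_bij_betw_nat_finite[of B] B(4) by (auto simp: atLeast0LessThan)
  have "T = cfun.span B" using B(3) cfun.span_minimal[OF B(1) T(1)] by (rule antisym)
  moreover have "B = b ` {..<cfun.dim T}" using b by (simp add: bij_betw_def)
  moreover have "b r \<notin> cfun.span (b ` {..<r})" if "r < cfun.dim T" for r
  proof
    assume "b r \<in> cfun.span (b ` {..<r})"
    moreover have "b ` {..<r} \<subseteq> B - {b r}"
    proof -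
      have "b l \<in> B \<and> b l \<noteq> b r" if "l < r" for l
        using that \<open>r < cfun.dim T\<close> b inj_onD[of b "{..<cfun.dim T}" l r]
        by (auto simp: bij_betw_def)
      then show ?thesis by auto
    qed
    ultimately have "b r \<in> cfun.span (B - {b r})" using cfun.span_mono by blast
    moreover have "b r \<in> B" using that b by (auto simp: bij_betw_def)
    ultimately show False using B(2) unfolding cfun.dependent_def by blast
  qed
  ultimately show ?thesis by (intro that[of b]) simp_all
qed

lemma span_subset_range_lin_param: "cfun.span (b ` {..<d}) \<subseteq> range (lin_param d b)"
proof (rule cfun.span_minimal)
  show "b ` {..<d} \<subseteq> range (lin_param d b)"
  proof
    fix v assume "v \<in> b ` {..<d}"
    then obtain l where l: "l < d" "v = b l" by auto
    have "lin_param d b (coord_vec l) = v"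
    proof
      fix i
      have "lin_param d b (coord_vec l) i = (\<Sum>l'<d. if l' = l then b l' i else 0)"
        unfolding lin_param_def by (rule sum.cong) (auto simp: coord_vec_def)
      then show "lin_param d b (coord_vec l) i = v i" using l by simp
    qed
    then show "v \<in> range (lin_param d b)" by (metis rangeI)
  qed
  have "lin_param d b 0 = 0" by (simp add: lin_param_def fun_eq_iff)
  moreover have "lin_param d b s + lin_param d b s' = lin_param d b (s + s')" for s s'
    by (simp add: lin_param_def fun_eq_iff algebra_simps sum.distrib)
  moreover have "cscale c (lin_param d b s) = lin_param d b (cscale c s)" for c s
    by (simp add: lin_param_def cscale_def fun_eq_iff sum_distrib_left mult.assoc)
  ultimately show "cfun.subspace (range (lin_param d b))"
    unfolding cfun.subspace_def by (auto intro: range_eqI[OF sym])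
qed

lemma vector_space_over_self: "vector_space ((*) :: complex \<Rightarrow> complex \<Rightarrow> complex)"
  by unfold_locales (auto simp: algebra_simps)

interpretation cfunl: vector_space_pair
  "cscale :: complex \<Rightarrow> ('i \<Rightarrow> complex) \<Rightarrow> 'i \<Rightarrow> complex" "(*) :: complex \<Rightarrow> complex \<Rightarrow> complex"
  using vector_space_over_self vector_space_cscale by (simp add: vector_space_pair_def)

text \<open>Extending a basis of the subspace by the given point allows a linear functional to be
  prescribed as \<open>0\<close> on the former and \<open>1\<close> on the latter. The point of stating it in coordinates is
  that the form is then a polynomial function.\<close>

lemma separating_linear_form:
  assumes I: "finite I" and U: "cfun.subspace U" "U \<subseteq> affine_space I"
    and x: "x \<in> affine_space I" "x \<notin> U"
  obtains c where "\<And>u. u \<in> U \<Longrightarrow> (\<Sum>i\<in>I. c i * u i) = 0" "(\<Sum>i\<in>I. c i * x i) \<noteq> 0"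
proof -
  obtain B where B: "B \<subseteq> U" "cfun.independent B" "U \<subseteq> cfun.span B"
    "card B = cfun.dim U" by (rule cfun.basis_exists)
  have spB: "cfun.span B = U" using cfun.span_minimal[OF B(1) U(1)] B(3) by (rule antisym)
  have "cfun.independent (insert x B)"
    using B(2) x(2) spB by (intro cfun.independent_insertI) simp_all
  then obtain l where l: "Vector_Spaces.linear cscale (*) l"
    "\<forall>y\<in>insert x B. l y = (if y = x then 1 else 0)"
    using cfunl.linear_independent_extend[of "insert x B" "\<lambda>y. if y = x then 1 else 0"] by blast
  interpret l: Vector_Spaces.linear cscale "(*)" l by (rule l(1))
  have expand: "(\<Sum>i\<in>I. l (coord_vec i) * v i) = l v" if "v \<in> affine_space I" for v
    by (subst (2) affine_space_expand[OF I that])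
      (simp add: l.sum l.scale mult.commute)
  have "l u = 0" if "u \<in> U" for u
  proof -
    have "u \<in> cfun.span B" using that spB by simp
    then show ?thesis
    proof (induction rule: cfun.span_induct_alt)
      case base
      show ?case by (rule l.zero)
    next
      case (step c y z)
      moreover have "y \<noteq> x" using step(1) B(1) x(2) by auto
      ultimately have "l y = 0" "l z = 0" using l(2) by auto
      then show ?case by (simp only: l.add l.scale) simp
    qed
  qed
  then show ?thesis using expand U(2) x l(2)
    by (intro that[of "\<lambda>i. l (coord_vec i)"]) auto
qed

lemma linear_form_poly: "(\<lambda>x. \<Sum>i\<in>I. c i * x i) \<in> poly_funs I"
  by (intro poly_funs_sum poly_funs.mult poly_funs.const poly_funs.coord)

lemma zariski_closed_translate:
  assumes I: "finite I" and U: "cfun.subspace U" "U \<subseteq> affine_space I" and a: "a \<in> affine_space I"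
  shows "zariski_closed I ((+) a ` U)"
proof -
  define S where "S = {(\<lambda>x. (\<Sum>i\<in>I. c i * x i) + - (\<Sum>i\<in>I. c i * a i)) |c.
    \<forall>u\<in>U. (\<Sum>i\<in>I. c i * u i) = 0}"
  have "S \<subseteq> poly_funs I"
    unfolding S_def by (blast intro: poly_funs.add[OF linear_form_poly poly_funs.const])
  moreover have "(+) a ` U = {x \<in> affine_space I. \<forall>g \<in> S. g x = 0}"
  proof (intro equalityI subsetI)
    fix x assume "x \<in> (+) a ` U"
    then obtain u where u: "u \<in> U" "x = a + u" by blast
    then have "x \<in> affine_space I" using a U(2) cfun.subspace_add[OF subspace_affine_space] by blast
    then show "x \<in> {x \<in> affine_space I. \<forall>g \<in> S. g x = 0}"
      using u by (auto simp: S_def algebra_simps sum.distrib)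
  next
    fix x assume x: "x \<in> {x \<in> affine_space I. \<forall>g \<in> S. g x = 0}"
    then have xa: "x - a \<in> affine_space I"
      using a cfun.subspace_diff[OF subspace_affine_space] by blast
    have "x - a \<in> U"
    proof (rule ccontr)
      assume "x - a \<notin> U"
      then obtain c where c: "\<And>u. u \<in> U \<Longrightarrow> (\<Sum>i\<in>I. c i * u i) = 0" "(\<Sum>i\<in>I. c i * (x - a) i) \<noteq> 0"
        using separating_linear_form[OF I U xa] by blast
      then have "(\<lambda>x. (\<Sum>i\<in>I. c i * x i) + - (\<Sum>i\<in>I. c i * a i)) \<in> S" unfolding S_def by blast
      moreover have "\<forall>g\<in>S. g x = 0" using x by simp
      ultimately have "(\<Sum>i\<in>I. c i * x i) + - (\<Sum>i\<in>I. c i * a i) = 0" by (rule bspec[rotated])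
      then show False using c(2) by (simp add: algebra_simps sum_subtractf)
    qed
    then show "x \<in> (+) a ` U" by (intro image_eqI[of _ _ "x - a"]) simp_all
  qed
  ultimately show ?thesis unfolding zariski_closed_def by blast
qed

text \<open>Two proper closed subsets cannot cover an affine-linear space: on the line joining a
  point outside the first to a point outside the second, each subset leaves out all but
  finitely many points.\<close>

lemma irreducible_closed_translate:
  assumes I: "finite I" and U: "cfun.subspace U" "U \<subseteq> affine_space I" and a: "a \<in> affine_space I"
  shows "irreducible_closed I ((+) a ` U)"
proof -
  have False if A: "zariski_closed I A" and B: "zariski_closed I B"
    and un: "(+) a ` U = A \<union> B" and neq: "(+) a ` U \<noteq> A" "(+) a ` U \<noteq> B" for A B
  proof -
    obtain u w where u: "u \<in> U" "a + u \<notin> A" and w: "w \<in> U" "a + w \<notin> B" using un neq by blast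
    have aff: "a + z \<in> affine_space I" if "z \<in> U" for z
      using that a U(2) cfun.subspace_add[OF subspace_affine_space] by blast
    obtain g h where g: "g \<in> poly_funs I" "\<forall>x\<in>A. g x = 0" "g (a + u) \<noteq> 0"
      and h: "h \<in> poly_funs I" "\<forall>x\<in>B. h x = 0" "h (a + w) \<noteq> 0"
      using A B aff[OF u(1)] aff[OF w(1)] u w unfolding zariski_closed_def by blast
    \<comment> \<open>the line from \<open>a + u\<close> to \<open>a + w\<close>\<close>
    define \<gamma> where "\<gamma> t = (\<lambda>i. (a + u) i + t * (w - u) i)" for t
    obtain p q where p: "\<And>t. g (\<gamma> t) = poly p t" and q: "\<And>t. h (\<gamma> t) = poly q t"
      using poly_funs_line[OF g(1)] poly_funs_line[OF h(1)] unfolding \<gamma>_def by metis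
    have "\<gamma> 0 = a + u" "\<gamma> 1 = a + w" by (auto simp: \<gamma>_def fun_eq_iff)
    then have "p \<noteq> 0" "q \<noteq> 0" using p[of 0] q[of 1] g h by auto
    then have "finite ({t. poly p t = 0} \<union> {t. poly q t = 0})" by (simp add: poly_roots_finite)
    then obtain t where t: "poly p t \<noteq> 0" "poly q t \<noteq> 0"
      using ex_new_if_finite[OF infinite_UNIV_char_0] by blast
    have "\<gamma> t = a + (u + cscale t (w - u))" by (simp add: \<gamma>_def cscale_def fun_eq_iff)
    moreover have "u + cscale t (w - u) \<in> U"
      using u w U(1) by (intro cfun.subspace_add cfun.subspace_scale cfun.subspace_diff)
    ultimately have "\<gamma> t \<in> A \<union> B" using un by blast
    then have "g (\<gamma> t) = 0 \<or> h (\<gamma> t) = 0" using g(2) h(2) by auto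
    then show False using t p q by simp
  qed
  moreover have "(+) a ` U \<noteq> {}" using cfun.subspace_0[OF U(1)] by blast
  ultimately show ?thesis
    unfolding irreducible_closed_def using zariski_closed_translate[OF assms] by blast
qed

lemma irreducible_chain_in_subspace_le:
  assumes I: "finite I" and T: "cfun.subspace T" "T \<subseteq> affine_space I"
    and irr: "\<And>r. r \<le> m \<Longrightarrow> irreducible_closed I (Z r)"
    and strict: "\<And>r. r < m \<Longrightarrow> Z r \<subset> Z (Suc r)"
    and sub: "Z m \<subseteq> T"
  shows "m \<le> cfun.dim T"
proof -
  obtain b where "T = cfun.span (b ` {..<cfun.dim T})" using subspace_flag[OF I T] by metis
  then have "Z m \<subseteq> range (lin_param (cfun.dim T) b)"
    using sub span_subset_range_lin_param by blast
  then show ?thesis using irreducible_chain_length_le[of m I Z] irr strict by blast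
qed

text \<open>The translates to \<open>a\<close> of a complete flag give a chain of maximal length.\<close>

lemma local_dim_subspace:
  assumes I: "finite I" and T: "cfun.subspace T" "T \<subseteq> affine_space I" and a: "a \<in> T"
  shows "local_dim I T a = enat (cfun.dim T)"
proof (rule antisym)
  show "local_dim I T a \<le> enat (cfun.dim T)"
    unfolding local_dim_def
  proof (rule Sup_least, clarify)
    fix m Z
    assume "\<forall>r\<le>m. irreducible_closed I (Z r) \<and> a \<in> Z r \<and> Z r \<subseteq> T" "\<forall>r<m. Z r \<subset> Z (Suc r)"
    then show "enat m \<le> enat (cfun.dim T)"
      using irreducible_chain_in_subspace_le[OF I T, of m Z] by simp
  qed
next
  obtain b where b: "T = cfun.span (b ` {..<cfun.dim T})"
    "\<And>r. r < cfun.dim T \<Longrightarrow> b r \<notin> cfun.span (b ` {..<r})"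
    using subspace_flag[OF I T] by metis
  define Z where "Z r = (+) a ` cfun.span (b ` {..<r})" for r
  have sub: "cfun.span (b ` {..<r}) \<subseteq> T" if "r \<le> cfun.dim T" for r
    by (subst b(1), rule cfun.span_mono) (use that in auto)
  have "irreducible_closed I (Z r) \<and> a \<in> Z r \<and> Z r \<subseteq> T" if "r \<le> cfun.dim T" for r
  proof (intro conjI)
    show "irreducible_closed I (Z r)"
      unfolding Z_def using sub[OF that] T a
      by (intro irreducible_closed_translate[OF I] cfun.subspace_span) auto
    show "a \<in> Z r" unfolding Z_def using cfun.span_zero by (intro image_eqI[of _ _ 0]) auto
    show "Z r \<subseteq> T" unfolding Z_def using sub[OF that] a cfun.subspace_add[OF T(1)] by blast
  qed
  moreover have "Z r \<subset> Z (Suc r)" if "r < cfun.dim T" for r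
  proof -
    have "cfun.span (b ` {..<r}) \<subseteq> cfun.span (b ` {..<Suc r})" by (rule cfun.span_mono) auto
    moreover have "b r \<in> cfun.span (b ` {..<Suc r})" by (rule cfun.span_base) auto
    ultimately have "cfun.span (b ` {..<r}) \<subset> cfun.span (b ` {..<Suc r})" using b(2)[OF that] by blast
    then show ?thesis unfolding Z_def
      using inj_image_subset_iff[of "(+) a"] inj_image_eq_iff[of "(+) a"] by (simp add: psubset_eq)
  qed
  ultimately have "\<exists>Z. (\<forall>r \<le> cfun.dim T. irreducible_closed I (Z r) \<and> a \<in> Z r \<and> Z r \<subseteq> T) \<and>
            (\<forall>r < cfun.dim T. Z r \<subset> Z (Suc r))" by blast
  then show "enat (cfun.dim T) \<le> local_dim I T a"
    unfolding local_dim_def by (intro Sup_upper) blast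
qed

lemma zariski_tangent_space_subspace:
  assumes I: "finite I" and T: "cfun.subspace T" "T \<subseteq> affine_space I" and a: "a \<in> T"
  shows "zariski_tangent_space I T a = T"
proof (intro equalityI subsetI)
  fix v assume v: "v \<in> T"
  have "((\<lambda>t. g (\<lambda>i. a i + t * v i)) has_field_derivative 0) (at 0)"
    if g: "g \<in> vanishing_ideal I T" for g
  proof -
    have "g (\<lambda>i. a i + t * v i) = 0" for t
    proof -
      have "a + cscale t v \<in> T" using T(1) a v by (intro cfun.subspace_add cfun.subspace_scale)
      then show ?thesis using g by (auto simp: vanishing_ideal_def cscale_def plus_fun_def)
    qed
    then show ?thesis by simp
  qed
  then show "v \<in> zariski_tangent_space I T a"
    using v T(2) by (auto simp: zariski_tangent_space_def)
next
  fix v assume v: "v \<in> zariski_tangent_space I T a"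
  show "v \<in> T"
  proof (rule ccontr)
    assume "v \<notin> T"
    moreover have "v \<in> affine_space I" using v by (simp add: zariski_tangent_space_def)
    ultimately obtain c where c: "\<And>u. u \<in> T \<Longrightarrow> (\<Sum>i\<in>I. c i * u i) = 0" "(\<Sum>i\<in>I. c i * v i) \<noteq> 0"
      using separating_linear_form[OF I T] by blast
    have "(\<lambda>x. \<Sum>i\<in>I. c i * x i) \<in> vanishing_ideal I T"
      using c(1) linear_form_poly by (simp add: vanishing_ideal_def)
    then have "((\<lambda>t. \<Sum>i\<in>I. c i * (a i + t * v i)) has_field_derivative 0) (at 0)"
      using v unfolding zariski_tangent_space_def by fast
    moreover have "((\<lambda>t. \<Sum>i\<in>I. c i * (a i + t * v i)) has_field_derivative (\<Sum>i\<in>I. c i * v i)) (at 0)"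
      by (auto intro!: derivative_eq_intros simp: mult.commute)
    ultimately show False using c(2) DERIV_unique by blast
  qed
qed

lemma affine_regular_at_subspace:
  assumes "finite I" "cfun.subspace T" "T \<subseteq> affine_space I" "a \<in> T"
  shows "affine_regular_at I T a"
  unfolding affine_regular_at_def
  using zariski_tangent_space_subspace[OF assms] local_dim_subspace[OF assms] by simp

section \<open>Cones\<close>

lemma subspace_zariski_tangent_space: "cfun.subspace (zariski_tangent_space I X p)"
proof -
  have *: "\<exists>l. (\<forall>v w. l (v + w) = l v + l w) \<and> (\<forall>c v. l (cscale c v) = c * l v) \<and>
     (\<forall>v. ((\<lambda>t. g (\<lambda>i. p i + t * v i)) has_field_derivative 0) (at 0) \<longleftrightarrow> l v = 0)"
    if g: "g \<in> vanishing_ideal I X" for g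
  proof -
    have "g \<in> poly_funs I" using g by (simp add: vanishing_ideal_def)
    then obtain l where l: "\<forall>v w. l (v + w) = l v + l w" "\<forall>c v. l (cscale c v) = c * l v"
      "\<And>v. ((\<lambda>t. g (\<lambda>i. p i + t * v i)) has_field_derivative l v) (at 0)"
      using poly_funs_differential[of g I p] by blast
    have "((\<lambda>t. g (\<lambda>i. p i + t * v i)) has_field_derivative 0) (at 0) \<longleftrightarrow> l v = 0" for v
      using l(3)[of v] DERIV_unique by auto
    with l(1,2) show ?thesis by blast
  qed
  have ss: "cfun.subspace {v. ((\<lambda>t. g (\<lambda>i. p i + t * v i)) has_field_derivative 0) (at 0)}"
    if g: "g \<in> vanishing_ideal I X" for g
  proof -
    obtain l where l: "\<forall>v w. l (v + w) = l v + l w" "\<forall>c v. l (cscale c v) = c * l v"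
     "\<And>v. ((\<lambda>t. g (\<lambda>i. p i + t * v i)) has_field_derivative 0) (at 0) \<longleftrightarrow> l v = 0"
      using *[OF g] by blast
    have "l 0 = 0" using l(2)[rule_format, of 0 0] by simp
    then show ?thesis unfolding l(3) cfun.subspace_def using l(1,2) by simp
  qed
  have "zariski_tangent_space I X p = affine_space I \<inter>
     (\<Inter>g\<in>vanishing_ideal I X. {v. ((\<lambda>t. g (\<lambda>i. p i + t * v i)) has_field_derivative 0) (at 0)})"
    by (auto simp: zariski_tangent_space_def)
  then show ?thesis
    using subspace_affine_space ss by (simp only:) (intro cfun.subspace_inter cfun.subspace_Inter, auto)
qed

text \<open>A polynomial vanishing on the cone vanishes on the line joining the apex to a point of the
  cone, except perhaps at the apex itself. It restricts there to a polynomial in one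
  variable with infinitely many roots, hence to the zero polynomial.\<close>

lemma cone_subset_tangent_space_at_apex:
  assumes X: "X \<subseteq> affine_space I" and cone: "\<And>t v. t \<noteq> 0 \<Longrightarrow> v \<in> X \<Longrightarrow> cscale t v \<in> X"
  shows "X \<subseteq> zariski_tangent_space I X 0"
proof
  fix v assume v: "v \<in> X"
  have "((\<lambda>t. g (\<lambda>i. 0 i + t * v i)) has_field_derivative 0) (at 0)"
    if g: "g \<in> vanishing_ideal I X" for g
  proof -
    obtain p where p: "\<And>t. g (\<lambda>i. 0 i + t * v i) = poly p t"
      using poly_funs_line[of g I 0 v] g by (auto simp: vanishing_ideal_def)
    have "poly p t = 0" if "t \<noteq> 0" for t
      using cone[OF that v] g p[of t] by (simp add: vanishing_ideal_def cscale_def)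
    then have "UNIV - {0} \<subseteq> {t. poly p t = 0}" by auto
    moreover have "infinite (UNIV - {0::complex})" by (simp add: infinite_UNIV_char_0)
    ultimately have "p = 0" using poly_roots_finite finite_subset by blast
    then show ?thesis by (simp only: p) simp
  qed
  then show "v \<in> zariski_tangent_space I X 0"
    using v X by (auto simp: zariski_tangent_space_def)
qed

lemma irreducible_closed_singleton:
  assumes "finite I" "a \<in> affine_space I"
  shows "irreducible_closed I {a}"
  using irreducible_closed_translate[OF assms(1) cfun.subspace_single_0 _ assms(2)]
  by (simp add: affine_space_def)

text \<open>Were \<open>X\<close> properly contained in its tangent space, the tangent space could be put on top
  of a maximal chain in \<open>X\<close>, giving a chain longer than its own dimension permits.\<close>

lemma cone_regular_at_apex_linear:
  assumes I: "finite I" and X: "X \<subseteq> affine_space I" and zero: "0 \<in> X"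
    and cone: "\<And>t v. t \<noteq> 0 \<Longrightarrow> v \<in> X \<Longrightarrow> cscale t v \<in> X"
    and reg: "affine_regular_at I X 0"
  shows "X = zariski_tangent_space I X 0"
proof -
  define T where "T = zariski_tangent_space I X 0"
  have T: "cfun.subspace T" "T \<subseteq> affine_space I"
    unfolding T_def by (rule subspace_zariski_tangent_space) (auto simp: zariski_tangent_space_def)
  have XT: "X \<subseteq> T" unfolding T_def by (rule cone_subset_tangent_space_at_apex[OF X cone])
  define C where "C = {enat m | m. \<exists>Z.
            (\<forall>r \<le> m. irreducible_closed I (Z r) \<and> 0 \<in> Z r \<and> Z r \<subseteq> X) \<and>
            (\<forall>r < m. Z r \<subset> Z (Suc r))}"
  have SupC: "Sup C = enat (cfun.dim T)"
    using reg unfolding affine_regular_at_def local_dim_def C_def T_def by simp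
  have "irreducible_closed I {0}" using irreducible_closed_singleton[OF I] X zero by blast
  then have "enat 0 \<in> C" unfolding C_def using zero
    by (intro CollectI exI[of _ "0::nat"] conjI exI[of _ "\<lambda>_. {0}"]) auto
  then have "C \<noteq> {}" by blast
  \<comment> \<open>the supremum is finite, so it is attained by a chain\<close>
  have "finite C"
    using finite_enat_bounded[of C "cfun.dim T"] Sup_upper[of _ C] SupC by auto
  then have "enat (cfun.dim T) \<in> C"
    using \<open>C \<noteq> {}\<close> SupC Max_in[of C] by (simp add: Sup_enat_def)
  then obtain Z where Z: "\<And>r. r \<le> cfun.dim T \<Longrightarrow> irreducible_closed I (Z r) \<and> 0 \<in> Z r \<and> Z r \<subseteq> X"
    "\<And>r. r < cfun.dim T \<Longrightarrow> Z r \<subset> Z (Suc r)"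
    unfolding C_def by auto
  have "T \<subseteq> X"
  proof (rule ccontr)
    assume "\<not> T \<subseteq> X"
    define Z' where "Z' r = (if r \<le> cfun.dim T then Z r else T)" for r
    have "Suc (cfun.dim T) \<le> cfun.dim T"
    proof (rule irreducible_chain_in_subspace_le[OF I T])
      show "irreducible_closed I (Z' r)" if "r \<le> Suc (cfun.dim T)" for r
        using Z(1) irreducible_closed_translate[OF I T, of 0] by (auto simp: Z'_def affine_space_def)
      show "Z' r \<subset> Z' (Suc r)" if "r < Suc (cfun.dim T)" for r
        using that Z(1)[of "cfun.dim T"] Z(2) \<open>\<not> T \<subseteq> X\<close> XT
        by (cases "r = cfun.dim T") (auto simp: Z'_def)
      show "Z' (Suc (cfun.dim T)) \<subseteq> T" by (simp add: Z'_def)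
    qed
    then show False by simp
  qed
  with XT show ?thesis by (simp add: T_def)
qed

theorem cone_regular_if_regular_at_apex:
  assumes "finite I" "X \<subseteq> affine_space I" "0 \<in> X"
    and "\<And>t v. t \<noteq> 0 \<Longrightarrow> v \<in> X \<Longrightarrow> cscale t v \<in> X"
    and "affine_regular_at I X 0" "a \<in> X"
  shows "affine_regular_at I X a"
proof -
  have "X = zariski_tangent_space I X 0" using assms by (intro cone_regular_at_apex_linear)
  then have "cfun.subspace X" using subspace_zariski_tangent_space by metis
  then show ?thesis using assms by (intro affine_regular_at_subspace)
qed

section \<open>Ranks and row spaces\<close>

lemma rank_le_if_cols_in_span:
  fixes A B :: "complex mat"
  assumes A: "A \<in> carrier_mat k p" and B: "B \<in> carrier_mat k q"
    and sub: "set (cols A) \<subseteq> vec_space.col_space k B"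
  shows "vec_space.rank k A \<le> vec_space.rank k B"
proof -
  interpret vec_space "TYPE(complex)" k .
  let ?S = "span (set (cols A))" and ?W = "span (set (cols B))"
  have cA: "set (cols A) \<subseteq> carrier V" and cB: "set (cols B) \<subseteq> carrier V"
    using A B cols_dim[of A] cols_dim[of B] by auto
  have "?S \<subseteq> ?W" using sub cB unfolding col_space_def
    by (intro span_is_subset) (auto intro: span_is_submodule)
  have subW: "VectorSpace.subspace class_ring ?W V" and subS: "VectorSpace.subspace class_ring ?S V"
    using cA cB by (auto intro: span_is_subspace)
  then have "VectorSpace.subspace class_ring ?S (vs ?W)" using \<open>?S \<subseteq> ?W\<close> nested_subspaces by blast
  moreover have "vectorspace class_ring (vs ?W)" using subspace_is_vs[OF subW] .
  moreover have "vectorspace.fin_dim class_ring (vs ?W)" "vectorspace.fin_dim class_ring (vs ?S)"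
    using cA cB by (auto intro!: fin_dim_span)
  ultimately have "vectorspace.dim class_ring (vs ?S) \<le> vectorspace.dim class_ring (vs ?W)"
    using vectorspace.subspace_dim[of class_ring "vs ?W" ?S] by simp
  then show ?thesis unfolding rank_def .
qed

text \<open>A relation between columns of \<open>C\<close> is preserved by multiplication with \<open>P\<close>; therefore
  columns of \<open>C\<close> lying over independent columns of \<open>P * C\<close> are themselves independent.\<close>

lemma rank_mult_le:
  fixes P C :: "complex mat"
  assumes P: "P \<in> carrier_mat k k" and C: "C \<in> carrier_mat k q"
  shows "vec_space.rank k (P * C) \<le> vec_space.rank k C"
proof -
  interpret vec_space "TYPE(complex)" k .
  have PC: "P * C \<in> carrier_mat k q" using P C by simp
  have "lin_indpt {}" by (rule finite_lin_indpt2) simp_all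
  then have "\<exists>U. finite U \<and> maximal U (\<lambda>T. T \<subseteq> set (cols (P * C)) \<and> lin_indpt T) \<and> {} \<subseteq> U"
    by (intro maximal_exists_superset[of "set (cols (P * C))"]) auto
  then obtain U where U: "maximal U (\<lambda>T. T \<subseteq> set (cols (P * C)) \<and> lin_indpt T)" by blast
  then have Us: "U \<subseteq> set (cols (P * C))" "lin_indpt U" by (auto simp: maximal_def)
  then have "finite U" using finite_subset by blast
  then obtain us where us: "set us = U" "distinct us" using finite_distinct_list by blast
  have "\<exists>c\<in>set (cols C). P *\<^sub>v c = u" if "u \<in> U" for u
  proof -
    have "u \<in> set (cols (P * C))" using that Us(1) by blast
    then obtain j where "j < length (cols (P * C))" "cols (P * C) ! j = u"
      unfolding in_set_conv_nth by blast
    then have j: "j < q" "u = col (P * C) j" using C by auto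
    then have "u = P *\<^sub>v col C j" using col_mult2[OF P C] by simp
    then show ?thesis using j C by (auto simp: cols_def)
  qed
  then obtain g where g: "\<And>u. u \<in> U \<Longrightarrow> g u \<in> set (cols C)" "\<And>u. u \<in> U \<Longrightarrow> P *\<^sub>v g u = u" by metis
  define ws where "ws = map g us"
  define C' where "C' = mat_of_cols k ws"
  have inj: "inj_on g U" using g(2) by (metis inj_onI)
  have "distinct ws" using us inj by (simp add: ws_def distinct_map)
  have "set ws \<subseteq> set (cols C)" using g(1) us by (auto simp: ws_def)
  then have ws_c: "set ws \<subseteq> carrier_vec k" using cols_dim C by blast
  have us_c: "set us \<subseteq> carrier_vec k" using Us(1) us PC cols_dim by blast
  have C': "C' \<in> carrier_mat k (length us)" by (auto simp: C'_def ws_def)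
  have colsC': "cols C' = ws" unfolding C'_def using ws_c by simp
  have "P * C' = mat_of_cols k us"
  proof (rule mat_col_eqI)
    fix j assume j: "j < dim_col (mat_of_cols k us)"
    then have "col (P * C') j = P *\<^sub>v col C' j" using C' P by (intro col_mult2) auto
    also have "col C' j = ws ! j" unfolding C'_def using j ws_c by (intro col_mat_of_cols) (auto simp: ws_def)
    also have "P *\<^sub>v ws ! j = us ! j" using j us g(2)[of "us ! j"] nth_mem[of j us] by (simp add: ws_def)
    also have "\<dots> = col (mat_of_cols k us) j" using j us_c by (intro col_mat_of_cols[symmetric]) auto
    finally show "col (P * C') j = col (mat_of_cols k us) j" .
  qed (use P C' in auto)
  then have colsPC': "cols (P * C') = us" using us_c by simp
  have "lin_indpt (set ws)"
  proof
    assume "lin_dep (set ws)"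
    then obtain v where v: "v \<in> carrier_vec (length us)" "v \<noteq> 0\<^sub>v (length us)" "C' *\<^sub>v v = 0\<^sub>v k"
      using lin_depE[OF C'] colsC' \<open>distinct ws\<close> by metis
    have "P * C' *\<^sub>v v = P *\<^sub>v (C' *\<^sub>v v)" using P C' v(1) by (rule assoc_mult_mat_vec)
    also have "\<dots> = 0\<^sub>v k" using P by (intro eq_vecI) (auto simp: v(3))
    finally have Pv: "P * C' *\<^sub>v v = 0\<^sub>v k" .
    have "P * C' \<in> carrier_mat k (length us)" using P C' by simp
    then have "lin_dep (set (cols (P * C')))"
      by (rule lin_depI[OF _ v(1,2) Pv]) (simp add: colsPC' us(2))
    then show False using Us(2) us colsPC' by simp
  qed
  then have "card (set ws) \<le> rank C"
    using rank_ge_card_indpt[OF C \<open>set ws \<subseteq> set (cols C)\<close>] by blast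
  moreover have "card (set ws) = card U" using us inj by (simp add: ws_def card_image)
  moreover have "rank (P * C) = card U" using rank_card_indpt[OF PC U] .
  ultimately show ?thesis by simp
qed

lemma row_space_subset_imp_factor:
  fixes M N :: "complex mat"
  assumes M: "M \<in> carrier_mat k n" and N: "N \<in> carrier_mat k n"
    and sub: "vec_space.row_space n M \<subseteq> vec_space.row_space n N"
  obtains P where "P \<in> carrier_mat k k" "M = P * N"
proof -
  interpret vec_space "TYPE(complex)" n .
  have "\<exists>y\<in>carrier_vec k. N\<^sup>T *\<^sub>v y = row M i" if "i < k" for i
  proof -
    have "row M i \<in> row_space M"
      unfolding row_space_def using M that rows_carrier[of M]
      by (intro subsetD[OF in_own_span]) (auto simp: rows_def)
    then have "row M i \<in> row_space N" using sub by blast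
    then show ?thesis unfolding row_space_eq[OF N] using N by auto
  qed
  then obtain y where y: "\<And>i. i < k \<Longrightarrow> y i \<in> carrier_vec k" "\<And>i. i < k \<Longrightarrow> N\<^sup>T *\<^sub>v y i = row M i"
    by metis
  define P where "P = mat k k (\<lambda>(i, j). y i $ j)"
  have P: "P \<in> carrier_mat k k" by (simp add: P_def)
  have "M = P * N"
  proof (rule eq_matI)
    fix i j assume ij: "i < dim_row (P * N)" "j < dim_col (P * N)"
    then have i: "i < k" and j: "j < n" using P N by auto
    have rP: "row P i = y i" using i y(1)[OF i] by (intro eq_vecI) (auto simp: P_def)
    have "M $$ (i, j) = (N\<^sup>T *\<^sub>v y i) $ j" using y(2)[OF i] M i j by simp
    also have "\<dots> = col N j \<bullet> y i" using N j by simp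
    also have "\<dots> = y i \<bullet> col N j" using N j y(1)[OF i] by (intro comm_scalar_prod[of _ k]) auto
    also have "\<dots> = (P * N) $$ (i, j)" using i j N P rP by simp
    finally show "M $$ (i, j) = (P * N) $$ (i, j)" .
  qed (use P M N in auto)
  then show ?thesis using that P by blast
qed

lemma row_space_mult_subset:
  fixes P A :: "complex mat"
  assumes P: "P \<in> carrier_mat k k" and A: "A \<in> carrier_mat k n"
  shows "vec_space.row_space n (P * A) \<subseteq> vec_space.row_space n A"
proof
  interpret vec_space "TYPE(complex)" n .
  have PA: "P * A \<in> carrier_mat k n" using P A by simp
  fix w assume "w \<in> row_space (P * A)"
  then obtain y where y: "y \<in> carrier_vec k" "w = (P * A)\<^sup>T *\<^sub>v y"
    unfolding row_space_eq[OF PA] using P by auto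
  have "(P * A)\<^sup>T *\<^sub>v y = A\<^sup>T *\<^sub>v (P\<^sup>T *\<^sub>v y)"
    unfolding transpose_mult[OF P A] using P A y by (intro assoc_mult_mat_vec) auto
  then show "w \<in> row_space A" unfolding row_space_eq[OF A] using y P A by auto
qed

lemma periodic_col_carrier:
  "1 \<le> n \<Longrightarrow> M \<in> carrier_mat k n \<Longrightarrow> periodic_col M i \<in> carrier_vec k"
  by (auto simp: periodic_col_def)

lemma periodic_col_index_less:
  "1 \<le> n \<Longrightarrow> nat ((i - 1) mod int n) < n"
  by (simp add: nat_less_iff)

text \<open>This makes the rank conditions independent of the matrix that represents a point of the
  Grassmannian: matrices with the same row space differ by a factor on the left, which acts
  on all columns simultaneously.\<close>

lemma interval_rank_row_space_mono:
  assumes n: "1 \<le> n" and M: "M \<in> carrier_mat k n" and N: "N \<in> carrier_mat k n"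
    and sub: "vec_space.row_space n M \<subseteq> vec_space.row_space n N"
  shows "interval_rank M i j \<le> interval_rank N i j"
proof -
  obtain P where P: "P \<in> carrier_mat k k" "M = P * N"
    using row_space_subset_imp_factor[OF M N sub] .
  have pc: "periodic_col M l = P *\<^sub>v periodic_col N l" for l
  proof -
    have cm: "col M c = P *\<^sub>v col N c" if "c < n" for c
      unfolding P(2) by (rule col_mult2[OF P(1) N that])
    have dims: "dim_col M = n" "dim_col N = n" using M N by auto
    show ?thesis unfolding periodic_col_def dims by (rule cm[OF periodic_col_index_less[OF n]])
  qed
  let ?C = "mat_of_cols k (map (periodic_col N) [i..j])"
  have C: "?C \<in> carrier_mat k (length [i..j])" by auto
  have "mat_of_cols k (map (periodic_col M) [i..j]) = P * ?C"
  proof (rule mat_col_eqI)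
    fix l assume "l < dim_col (P * ?C)"
    then have l: "l < length [i..j]" by simp
    have "col (mat_of_cols k (map (periodic_col M) [i..j])) l = P *\<^sub>v periodic_col N ([i..j] ! l)"
      using l pc periodic_col_carrier[OF n M] by (subst col_mat_of_cols) auto
    also have "\<dots> = P *\<^sub>v col ?C l"
      using l periodic_col_carrier[OF n N] by (subst col_mat_of_cols) auto
    also have "\<dots> = col (P * ?C) l" using P(1) C l by (intro col_mult2[symmetric]) auto
    finally show "col (mat_of_cols k (map (periodic_col M) [i..j])) l = col (P * ?C) l" .
  qed (use P in auto)
  then show ?thesis
    unfolding interval_rank_def using rank_mult_le[OF P(1) C] M N by simp
qed

text \<open>The factors may be \<open>0\<close>, which is how the limit of a torus orbit is reached without any
  appeal to semicontinuity.\<close>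

lemma interval_rank_col_scale_le:
  assumes n: "1 \<le> n" and M: "M \<in> carrier_mat k n" and N: "N \<in> carrier_mat k n"
    and cols: "\<And>c. c < n \<Longrightarrow> col M c = s c \<cdot>\<^sub>v col N c"
  shows "interval_rank M i j \<le> interval_rank N i j"
proof -
  interpret vec_space "TYPE(complex)" k .
  let ?M = "mat_of_cols k (map (periodic_col M) [i..j])"
  let ?N = "mat_of_cols k (map (periodic_col N) [i..j])"
  have cM: "set (map (periodic_col M) [i..j]) \<subseteq> carrier_vec k"
    and cN: "set (map (periodic_col N) [i..j]) \<subseteq> carrier_vec k"
    using periodic_col_carrier[OF n M] periodic_col_carrier[OF n N] by auto
  have "set (cols ?M) \<subseteq> col_space ?N"
  proof
    fix v assume "v \<in> set (cols ?M)"
    then obtain l where l: "l \<in> {i..j}" "v = periodic_col M l" using cM by auto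
    define c where "c = nat ((l - 1) mod int n)"
    have "v = s c \<cdot>\<^sub>v periodic_col N l"
      unfolding l(2) periodic_col_def using cols[of c] periodic_col_index_less[OF n] M N
      by (simp add: c_def)
    moreover have "periodic_col N l \<in> span (set (cols ?N))"
      using l cN by (intro subsetD[OF in_own_span]) auto
    ultimately show "v \<in> col_space ?N"
      unfolding col_space_def using cN by (auto intro!: smult_in_span)
  qed
  then show ?thesis
    unfolding interval_rank_def using M N
    by (auto intro!: rank_le_if_cols_in_span)
qed

section \<open>Positroid varieties in charts are cones\<close>

lemma chart_mat_carrier: "chart_mat n L a \<in> carrier_mat (card L) n"
  by (simp add: chart_mat_def)

lemma chart_mat_full_rank:
  assumes L: "L \<subseteq> {1..n}"
  shows "chart_mat n L a \<in> full_rank_mats (card L) n"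
proof -
  let ?k = "card L" and ?M = "chart_mat n L a"
  interpret vec_space "TYPE(complex)" ?k .
  have fin: "finite L" using L finite_subset by blast
  have full: "col_space (1\<^sub>m ?k) = carrier_vec ?k"
    unfolding col_space_eq[OF one_carrier_mat] by auto
  have one: "rank (1\<^sub>m ?k) = ?k" by (intro low_rank_det_zero) auto
  have "rank ?M \<le> rank (1\<^sub>m ?k)"
    using chart_mat_carrier[of n L a] cols_dim[of ?M]
    by (intro rank_le_if_cols_in_span[of _ _ n _ ?k]) (auto simp: full)
  moreover have "rank (1\<^sub>m ?k) \<le> rank ?M"
  proof (rule rank_le_if_cols_in_span[of _ _ ?k _ n])
    have "unit_vec ?k r \<in> set (cols ?M)" if r: "r < ?k" for r
    proof -
      define j where "j = sorted_list_of_set L ! r"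
      have len: "length (sorted_list_of_set L) = ?k" using fin by simp
      have jL: "j \<in> L" unfolding j_def using r fin len by (metis nth_mem set_sorted_list_of_set)
      have j: "1 \<le> j" "j \<le> n" using jL L by auto
      have eq: "sorted_list_of_set L ! r' = j \<longleftrightarrow> r' = r" if "r' < ?k" for r'
        unfolding j_def using that r len by (simp add: nth_eq_iff_index_eq)
      have "col ?M (j - 1) = unit_vec ?k r"
        using j jL r eq by (intro eq_vecI) (auto simp: chart_mat_def Let_def)
      moreover have "col ?M (j - 1) \<in> set (cols ?M)"
        using j chart_mat_carrier[of n L a] by (auto simp: cols_def)
      ultimately show ?thesis by simp
    qed
    then have "set (cols (1\<^sub>m ?k)) \<subseteq> set (cols ?M)" by (auto simp: cols_def)
    also have "\<dots> \<subseteq> col_space ?M"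
      unfolding col_space_def using chart_mat_carrier[of n L a] cols_dim[of ?M]
      by (intro in_own_span) auto
    finally show "set (cols (1\<^sub>m ?k)) \<subseteq> col_space ?M" .
  qed (auto simp: chart_mat_carrier)
  ultimately show ?thesis using one chart_mat_carrier by (simp add: full_rank_mats_def)
qed

lemma chart_plane_in_positroid_variety_iff:
  assumes n: "1 \<le> n" and L: "L \<subseteq> {1..n}"
  shows "chart_plane n L a \<in> positroid_variety (card L) n f \<longleftrightarrow>
    (\<forall>i j. i \<le> j \<and> j \<le> i + int n \<longrightarrow>
       int (interval_rank (chart_mat n L a) i j) \<le> (j - i + 1) - int (card {a. i \<le> a \<and> f a \<le> j}))"
    (is "?P \<longleftrightarrow> ?R")
proof
  assume ?P
  then obtain M where M: "vec_space.row_space n (chart_mat n L a) = vec_space.row_space n M"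
    "M \<in> full_rank_mats (card L) n"
    "\<forall>i j. i \<le> j \<and> j \<le> i + int n \<longrightarrow>
       int (interval_rank M i j) \<le> (j - i + 1) - int (card {a. i \<le> a \<and> f a \<le> j})"
    unfolding positroid_variety_def chart_plane_def by blast
  have "interval_rank (chart_mat n L a) i j \<le> interval_rank M i j" for i j
    using M(1,2) by (intro interval_rank_row_space_mono[OF n chart_mat_carrier])
      (auto simp: full_rank_mats_def)
  then show ?R using M(3) by (meson of_nat_mono order_trans)
next
  assume ?R
  then show ?P
    unfolding positroid_variety_def chart_plane_def using chart_mat_full_rank[OF L] by blast
qed

text \<open>For \<open>t \<noteq> 0\<close> this is invariance under a one-parameter subgroup of the torus; \<open>t = 0\<close> is
  its limit and shows that the origin belongs to the chart part as soon as any point does.\<close>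

lemma positroid_chart_part_scale:
  assumes n: "1 \<le> n" and L: "L \<subseteq> {1..n}"
    and a: "a \<in> chart_part n L (positroid_variety (card L) n f)"
  shows "cscale t a \<in> chart_part n L (positroid_variety (card L) n f)"
proof -
  have cols: "col (chart_mat n L (cscale t a)) c = (if Suc c \<in> L then 1 else t) \<cdot>\<^sub>v col (chart_mat n L a) c"
    if "c < n" for c
    using that by (intro eq_vecI) (auto simp: chart_mat_def cscale_def Let_def)
  have "interval_rank (chart_mat n L (cscale t a)) i j \<le> interval_rank (chart_mat n L a) i j" for i j
    by (rule interval_rank_col_scale_le[OF n chart_mat_carrier chart_mat_carrier cols])
  then have "chart_plane n L (cscale t a) \<in> positroid_variety (card L) n f"
    using a unfolding chart_part_def chart_plane_in_positroid_variety_iff[OF n L] mem_Collect_eq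
    by (meson of_nat_mono order_trans)
  then show ?thesis using a cfun.subspace_scale[OF subspace_affine_space]
    by (auto simp: chart_part_def)
qed

lemma coord_plane_eq_chart_plane:
  assumes L: "L \<subseteq> {1..n}"
  shows "coord_plane n L = chart_plane n L 0"
proof -
  interpret vec_space "TYPE(complex)" n .
  have fin: "finite L" using L finite_subset by blast
  have row: "row (chart_mat n L 0) r = unit_vec n (sorted_list_of_set L ! r - 1)" if "r < card L" for r
  proof -
    have "sorted_list_of_set L ! r \<in> L"
      using that fin by (metis nth_mem set_sorted_list_of_set length_sorted_list_of_set)
    then have "1 \<le> sorted_list_of_set L ! r" "sorted_list_of_set L ! r \<le> n"
      "sorted_list_of_set L ! r \<in> L" using L by auto
    then show ?thesis using that by (intro eq_vecI) (auto simp: chart_mat_def Let_def)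
  qed
  have "set (rows (chart_mat n L 0)) = (\<lambda>r. row (chart_mat n L 0) r) ` {..<card L}"
    by (auto simp: rows_def chart_mat_def)
  also have "\<dots> = (\<lambda>i. unit_vec n (i - 1)) ` ((\<lambda>r. sorted_list_of_set L ! r) ` {..<card L})"
    unfolding image_image using row by (intro image_cong) auto
  also have "(\<lambda>r. sorted_list_of_set L ! r) ` {..<card L} = L"
  proof -
    have "(\<lambda>r. sorted_list_of_set L ! r) ` {..<card L} = set (sorted_list_of_set L)"
      by (auto simp: set_conv_nth)
    then show ?thesis using fin by simp
  qed
  finally have rows: "set (rows (chart_mat n L 0)) = (\<lambda>i. unit_vec n (i - 1)) ` L" .
  show ?thesis unfolding coord_plane_def chart_plane_def row_space_def rows ..
qed

section \<open>Torus-fixed points and the theorem\<close>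

lemma mult_diagonal_mat_index:
  fixes A D :: "'a :: comm_ring_1 mat"
  assumes A: "A \<in> carrier_mat m n" and D: "D \<in> carrier_mat n n" "diagonal_mat D"
    and ij: "i < m" "j < n"
  shows "(A * D) $$ (i, j) = A $$ (i, j) * D $$ (j, j)"
proof -
  have "(A * D) $$ (i, j) = (\<Sum>l = 0..<n. A $$ (i, l) * D $$ (l, j))"
    using A D(1) ij by (simp add: scalar_prod_def)
  also have "\<dots> = (\<Sum>l = 0..<n. if l = j then A $$ (i, l) * D $$ (l, j) else 0)"
    using D ij by (intro sum.cong) (auto simp: diagonal_mat_def)
  finally show ?thesis using ij by simp
qed

lemma diagonal_mat_mult_index:
  fixes A D :: "'a :: comm_ring_1 mat"
  assumes A: "A \<in> carrier_mat m n" and D: "D \<in> carrier_mat m m" "diagonal_mat D"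
    and ij: "i < m" "j < n"
  shows "(D * A) $$ (i, j) = D $$ (i, i) * A $$ (i, j)"
proof -
  have "(D * A) $$ (i, j) = (\<Sum>l = 0..<m. D $$ (i, l) * A $$ (l, j))"
    using A D(1) ij by (simp add: scalar_prod_def)
  also have "\<dots> = (\<Sum>l = 0..<m. if l = i then D $$ (i, l) * A $$ (l, j) else 0)"
    using D ij by (intro sum.cong) (auto simp: diagonal_mat_def)
  finally show ?thesis using ij by simp
qed

lemma torus_diagonal_nonzero:
  assumes D: "D \<in> torus n" and i: "i < n"
  shows "D $$ (i, i) \<noteq> 0"
proof -
  have Dc: "D \<in> carrier_mat n n" "diagonal_mat D" "invertible_mat D"
    using D by (auto simp: torus_def)
  then obtain E where E: "inverts_mat D E" "inverts_mat E D" by (auto simp: invertible_mat_def)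
  then have ED: "E * D = 1\<^sub>m (dim_row E)" and DE: "D * E = 1\<^sub>m n"
    using Dc by (auto simp: inverts_mat_def)
  have "dim_col E = n" using DE by (metis index_mult_mat(3) index_one_mat(3))
  moreover have "dim_row E = n" using ED Dc by (metis index_mult_mat(3) index_one_mat(3) carrier_matD(2))
  ultimately have "E \<in> carrier_mat n n" by auto
  then have "D $$ (i, i) * E $$ (i, i) = (D * E) $$ (i, i)"
    using diagonal_mat_mult_index[of E n n D i i] Dc i by simp
  then show ?thesis using DE i by auto
qed

text \<open>For the matrix \<open>C\<close> of the coordinate plane, scaling columns amounts to scaling rows: each
  row has a single nonzero entry. So \<open>C * D = E * C\<close> with \<open>E\<close> diagonal and invertible, and any
  other representing matrix is obtained from \<open>C\<close> by a factor on the left.\<close>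

lemma coord_plane_torus_fixed:
  assumes L: "L \<subseteq> {1..n}"
  shows "coord_plane n L \<in> torus_fixed_points (card L) n"
proof -
  let ?C = "chart_mat n L 0" and ?k = "card L"
  have C: "?C \<in> carrier_mat ?k n" by (rule chart_mat_carrier)
  have cp: "coord_plane n L = vec_space.row_space n ?C"
    using coord_plane_eq_chart_plane[OF L] by (simp add: chart_plane_def)
  have "vec_space.row_space n (M * D) = vec_space.row_space n ?C"
    if M: "M \<in> full_rank_mats ?k n" and eq: "vec_space.row_space n M = vec_space.row_space n ?C"
      and D: "D \<in> torus n" for M D
  proof
    have Mc: "M \<in> carrier_mat ?k n" using M by (simp add: full_rank_mats_def)
    have Dc: "D \<in> carrier_mat n n" "diagonal_mat D" using D by (auto simp: torus_def)
    \<comment> \<open>the entry of \<open>D\<close> that acts on the column in which row \<open>r\<close> is nonzero\<close>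
    define d where "d r = D $$ (sorted_list_of_set L ! r - 1, sorted_list_of_set L ! r - 1)" for r
    have fin: "finite L" using L finite_subset by blast
    have d: "d r \<noteq> 0" if "r < ?k" for r
    proof -
      have "sorted_list_of_set L ! r \<in> L"
        using that fin by (metis nth_mem set_sorted_list_of_set length_sorted_list_of_set)
      then have "sorted_list_of_set L ! r \<in> {1..n}" using L by blast
      then show ?thesis unfolding d_def by (intro torus_diagonal_nonzero[OF D]) auto
    qed
    have entry: "?C $$ (r, c) * D $$ (c, c) = d r * ?C $$ (r, c)" if "r < ?k" "c < n" for r c
      using that by (auto simp: chart_mat_def d_def Let_def)
    define E where "E = mat ?k ?k (\<lambda>(r, s). if r = s then d r else 0)"
    define E' where "E' = mat ?k ?k (\<lambda>(r, s). if r = s then inverse (d r) else 0)"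
    have E: "E \<in> carrier_mat ?k ?k" "diagonal_mat E" "E' \<in> carrier_mat ?k ?k" "diagonal_mat E'"
      by (auto simp: E_def E'_def diagonal_mat_def)
    have CD: "?C * D \<in> carrier_mat ?k n" using C Dc by simp
    have CE: "?C * D = E * ?C"
    proof (rule eq_matI)
      fix r c assume "r < dim_row (E * ?C)" "c < dim_col (E * ?C)"
      then have "r < ?k" "c < n" using C E by auto
      then show "(?C * D) $$ (r, c) = (E * ?C) $$ (r, c)"
        using entry mult_diagonal_mat_index[OF C Dc] diagonal_mat_mult_index[OF C E(1,2)]
        by (simp add: E_def)
    qed (use C E Dc in auto)
    have CE': "?C = E' * (?C * D)"
    proof (rule eq_matI)
      fix r c assume "r < dim_row (E' * (?C * D))" "c < dim_col (E' * (?C * D))"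
      then have rc: "r < ?k" "c < n" using CD E by auto
      have "(E' * (?C * D)) $$ (r, c) = inverse (d r) * (d r * ?C $$ (r, c))"
        using rc entry diagonal_mat_mult_index[OF CD E(3,4)] mult_diagonal_mat_index[OF C Dc]
        by (simp add: E'_def)
      then show "?C $$ (r, c) = (E' * (?C * D)) $$ (r, c)" using d[OF rc(1)] by simp
    qed (use C E Dc in auto)
    obtain P where P: "P \<in> carrier_mat ?k ?k" "M = P * ?C"
      using row_space_subset_imp_factor[OF Mc C] eq by blast
    have "M * D = P * (?C * D)" unfolding P(2) using P(1) C Dc(1) by (rule assoc_mult_mat)
    also have "\<dots> = (P * E) * ?C" unfolding CE using P(1) E(1) C by (intro assoc_mult_mat[symmetric])
    finally show "vec_space.row_space n (M * D) \<subseteq> vec_space.row_space n ?C"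
      using row_space_mult_subset[of "P * E" ?k ?C n] P(1) E(1) C by simp
    obtain Q where Q: "Q \<in> carrier_mat ?k ?k" "?C = Q * M"
      using row_space_subset_imp_factor[OF C Mc] eq by blast
    have "?C = E' * (?C * D)" by (rule CE')
    also have "?C * D = Q * (M * D)" by (subst Q(2), rule assoc_mult_mat[OF Q(1) Mc Dc(1)])
    also have "E' * (Q * (M * D)) = (E' * Q) * (M * D)"
      using E(3) Q(1) Mc Dc(1) by (intro assoc_mult_mat[symmetric]) auto
    finally have "?C = (E' * Q) * (M * D)" .
    moreover have "M * D \<in> carrier_mat ?k n" "E' * Q \<in> carrier_mat ?k ?k"
      using Mc Dc(1) E(3) Q(1) by auto
    ultimately show "vec_space.row_space n ?C \<subseteq> vec_space.row_space n (M * D)"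
      using row_space_mult_subset[of "E' * Q" ?k "M * D" n] by simp
  qed
  moreover have "vec_space.row_space n ?C \<in> Gr ?k n"
    unfolding Gr_def using chart_mat_full_rank[OF L] by blast
  ultimately show ?thesis unfolding torus_fixed_points_def cp by blast
qed

lemma coord_plane_singular_if_chart_singular:
  assumes n: "1 \<le> n" and L: "L \<subseteq> {1..n}"
    and a: "a \<in> chart_part n L (positroid_variety (card L) n f)"
    and sing: "\<not> affine_regular_at (chart_index n L) (chart_part n L (positroid_variety (card L) n f)) a"
  shows "coord_plane n L \<in> singular_locus (card L) n (positroid_variety (card L) n f)"
proof -
  let ?X = "chart_part n L (positroid_variety (card L) n f)" and ?I = "chart_index n L"
  have "cscale 0 a = 0" by (simp add: cscale_def fun_eq_iff)
  then have zero: "0 \<in> ?X" using positroid_chart_part_scale[OF n L a, of 0] by simp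
  have fin: "finite ?I" using L finite_subset[of L "{1..n}"] by (auto simp: chart_index_def)
  have "\<not> affine_regular_at ?I ?X 0"
  proof
    assume reg: "affine_regular_at ?I ?X 0"
    have "?X \<subseteq> affine_space ?I" by (auto simp: chart_part_def)
    then have "affine_regular_at ?I ?X a"
      by (rule cone_regular_if_regular_at_apex[OF fin _ zero positroid_chart_part_scale[OF n L] reg a])
    with sing show False by blast
  qed
  then show ?thesis
    unfolding singular_locus_def coord_plane_eq_chart_plane[OF L] using L zero
    by (intro CollectI exI[of _ L] exI[of _ "0 :: nat \<times> nat \<Rightarrow> complex"] conjI refl)
qed

theorem theorem6:
  fixes k n :: nat and f :: "int \<Rightarrow> int" and X :: "complex vec set set"
  assumes "1 \<le> n"
    and "bounded_affine_perm k n f"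
    and "X = positroid_variety k n f"
  shows "(singular_locus k n X \<noteq> {} \<longleftrightarrow>
            (\<exists>L. L \<subseteq> {1..n} \<and> card L = k \<and> coord_plane n L \<in> singular_locus k n X)) \<and>
         (singular_locus k n X \<noteq> {} \<longleftrightarrow>
            singular_locus k n X \<inter> torus_fixed_points k n \<noteq> {}) \<and>
         ((\<forall>p \<in> X. smooth_at k n X p) \<longleftrightarrow>
            (\<forall>L. L \<subseteq> {1..n} \<and> card L = k \<and> coord_plane n L \<in> X \<longrightarrow>
               smooth_at k n X (coord_plane n L)))"
proof -
  have degenerate: "\<exists>L. L \<subseteq> {1..n} \<and> card L = k \<and> coord_plane n L \<in> singular_locus k n X"
    if nonempty: "singular_locus k n X \<noteq> {}"
  proof -
    obtain L a where "L \<subseteq> {1..n}" "card L = k" "a \<in> chart_part n L X"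
      "\<not> affine_regular_at (chart_index n L) (chart_part n L X) a"
      using nonempty unfolding singular_locus_def by blast
    then have "coord_plane n L \<in> singular_locus k n X"
      using coord_plane_singular_if_chart_singular[OF assms(1)] assms(3) by blast
    then show ?thesis using \<open>L \<subseteq> {1..n}\<close> \<open>card L = k\<close> by blast
  qed
  have fixed: "coord_plane n L \<in> torus_fixed_points k n" if "L \<subseteq> {1..n}" "card L = k" for L
    using coord_plane_torus_fixed that by blast
  have sub: "singular_locus k n X \<subseteq> X"
    by (auto simp: singular_locus_def chart_part_def)
  have fixed_point: "singular_locus k n X \<inter> torus_fixed_points k n \<noteq> {}"
    if "singular_locus k n X \<noteq> {}"
  proof -
    from degenerate[OF that] obtain L
      where "L \<subseteq> {1..n}" "card L = k" "coord_plane n L \<in> singular_locus k n X"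
      by (elim exE conjE)
    then have "coord_plane n L \<in> singular_locus k n X \<inter> torus_fixed_points k n"
      using fixed by simp
    then show ?thesis by (metis empty_iff)
  qed
  have smooth: "singular_locus k n X = {}"
    if "\<forall>L. L \<subseteq> {1..n} \<and> card L = k \<and> coord_plane n L \<in> X \<longrightarrow> smooth_at k n X (coord_plane n L)"
  proof (rule ccontr)
    assume "singular_locus k n X \<noteq> {}"
    from degenerate[OF this] obtain L
      where L: "L \<subseteq> {1..n}" "card L = k" "coord_plane n L \<in> singular_locus k n X"
      by (elim exE conjE)
    have "coord_plane n L \<in> X" using sub L(3) by (rule subsetD)
    then have "smooth_at k n X (coord_plane n L)" using that L(1,2) by blast
    with L show False by (simp add: smooth_at_def)
  qed
  have "singular_locus k n X \<noteq> {} \<longleftrightarrow>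
      (\<exists>L. L \<subseteq> {1..n} \<and> card L = k \<and> coord_plane n L \<in> singular_locus k n X)"
    using degenerate by (metis empty_iff)
  moreover have "singular_locus k n X \<noteq> {} \<longleftrightarrow>
      singular_locus k n X \<inter> torus_fixed_points k n \<noteq> {}"
    using fixed_point by (metis Int_empty_left)
  moreover have "(\<forall>p \<in> X. smooth_at k n X p) \<longleftrightarrow>
      (\<forall>L. L \<subseteq> {1..n} \<and> card L = k \<and> coord_plane n L \<in> X \<longrightarrow> smooth_at k n X (coord_plane n L))"
  proof
    assume "\<forall>L. L \<subseteq> {1..n} \<and> card L = k \<and> coord_plane n L \<in> X \<longrightarrow>
      smooth_at k n X (coord_plane n L)"
    then have "singular_locus k n X = {}" by (rule smooth)
    then show "\<forall>p \<in> X. smooth_at k n X p" by (simp add: smooth_at_def)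
  qed simp
  ultimately show ?thesis by (intro conjI)
qed

end
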